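(* Let $C\subseteq\{R,L,Fa\}$. Then the varieties $\mathcal{V}(C,D,N)$ and $\mathcal{V}_H(C,N)$ have the amalgamation property.
   Context: A $\nabla$-algebra is a tuple $\mathcal{A}=(\mathsf{A},\nabla,\to)$ where $\mathsf{A}=(A,\wedge,\vee,0,1)$ is a bounded lattice, $\nabla$ is a unary and $\to$ a binary operation on $A$, such that for all $a,b,c\in A$: $\nabla c\wedge a\leq b$ iff $c\leq a\to b$. Conditions: $(D)$ $\mathsf{A}$ is distributive; $(N)$ $\nabla1=1$ and $\nabla(a\wedge b)=\nabla a\wedge\nabla b$ for all $a,b$; $(R)$ $a\leq\nabla a$ for all $a$; $(L)$ $\nabla a\leq a$ for all $a$; $(Fa)$ $\nabla$ is surjective. $\mathcal{V}(C,D,N)$ is the class of all $\nabla$-algebras satisfying $(D)$, $(N)$ and all conditions in $C$. An explicitly Heyting $\nabla$-algebra is $(\mathsf{A},\nabla,\to,\supset)$ where $(\mathsf{A},\nabla,\to)$ is a $\nabla$-algebra and $\supset$ is the Heyting implication on $\mathsf{A}$; $\mathcal{V}_H(C,N)$ is the class of all explicitly Heyting $\nabla$-algebras satisfying $(N)$ and all conditions in $C$. A $\nabla$-algebra morphism is a bounded lattice morphism preserving $\nabla$ and $\to$; a Heyting $\nabla$-algebra morphism also preserves $\supset$; an embedding is an injective morphism. A class $\mathfrak{C}$ of $\nabla$-algebras has the amalgamation property if for any $\mathcal{A}_0,\mathcal{A}_1,\mathcal{A}_2\in\mathfrak{C}$ and any $\nabla$-algebra embeddings $f_1:\mathcal{A}_0\to\mathcal{A}_1$,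 $f_2:\mathcal{A}_0\to\mathcal{A}_2$, there exist $\mathcal{B}\in\mathfrak{C}$ and $\nabla$-algebra embeddings $g_1:\mathcal{A}_1\to\mathcal{B}$, $g_2:\mathcal{A}_2\to\mathcal{B}$ with $g_1\circ f_1=g_2\circ f_2$. For a class of explicitly Heyting $\nabla$-algebras the property is defined in the same way with Heyting $\nabla$-algebra morphisms everywhere in place of $\nabla$-algebra morphisms. *)

theory Defs
  imports "HOL-Algebra.Lattice"
begin

record 'a nabla_algebra = "'a gorder" +
  nabla :: "'a \<Rightarrow> 'a"
  imp :: "'a \<Rightarrow> 'a \<Rightarrow> 'a"

record 'a heyting_nabla_algebra = "'a nabla_algebra" +
  himp :: "'a \<Rightarrow> 'a \<Rightarrow> 'a"

locale nabla_algebra = bounded_lattice A for A (structure) +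
  assumes nabla_closed: "a \<in> carrier A \<Longrightarrow> nabla A a \<in> carrier A"
    and imp_closed: "\<lbrakk>a \<in> carrier A; b \<in> carrier A\<rbrakk> \<Longrightarrow> imp A a b \<in> carrier A"
    and nabla_imp_adjoint:
      "\<lbrakk>a \<in> carrier A; b \<in> carrier A; c \<in> carrier A\<rbrakk>
        \<Longrightarrow> nabla A c \<sqinter> a \<sqsubseteq> b \<longleftrightarrow> c \<sqsubseteq> imp A a b"

locale heyting_nabla_algebra = nabla_algebra A for A (structure) +
  assumes himp_closed: "\<lbrakk>a \<in> carrier A; b \<in> carrier A\<rbrakk> \<Longrightarrow> himp A a b \<in> carrier A"
    and himp_adjoint:
      "\<lbrakk>a \<in> carrier A; b \<in> carrier A; c \<in> carrier A\<rbrakk>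
        \<Longrightarrow> c \<sqinter> a \<sqsubseteq> b \<longleftrightarrow> c \<sqsubseteq> himp A a b"

datatype condition = Cond_D | Cond_N | Cond_R | Cond_L | Cond_Fa

fun satisfies :: "('a, 'm) nabla_algebra_scheme \<Rightarrow> condition \<Rightarrow> bool" where
  "satisfies A Cond_D \<longleftrightarrow>
    (\<forall>a\<in>carrier A. \<forall>b\<in>carrier A. \<forall>c\<in>carrier A.
      a \<sqinter>\<^bsub>A\<^esub> (b \<squnion>\<^bsub>A\<^esub> c) = (a \<sqinter>\<^bsub>A\<^esub> b) \<squnion>\<^bsub>A\<^esub> (a \<sqinter>\<^bsub>A\<^esub> c))"
| "satisfies A Cond_N \<longleftrightarrow>
    nabla A \<top>\<^bsub>A\<^esub> = \<top>\<^bsub>A\<^esub> \<and>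
    (\<forall>a\<in>carrier A. \<forall>b\<in>carrier A. nabla A (a \<sqinter>\<^bsub>A\<^esub> b) = nabla A a \<sqinter>\<^bsub>A\<^esub> nabla A b)"
| "satisfies A Cond_R \<longleftrightarrow> (\<forall>a\<in>carrier A. a \<sqsubseteq>\<^bsub>A\<^esub> nabla A a)"
| "satisfies A Cond_L \<longleftrightarrow> (\<forall>a\<in>carrier A. nabla A a \<sqsubseteq>\<^bsub>A\<^esub> a)"
| "satisfies A Cond_Fa \<longleftrightarrow> nabla A ` carrier A = carrier A"

definition variety :: "condition set \<Rightarrow> 'a nabla_algebra set" where
  "variety C = {A. nabla_algebra A \<and> (\<forall>c\<in>C. satisfies A c)}"

definition variety_H :: "condition set \<Rightarrow> 'a heyting_nabla_algebra set" where
  "variety_H C = {A. heyting_nabla_algebra A \<and> (\<forall>c\<in>C. satisfies A c)}"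

definition nabla_hom ::
  "('a, 'm) nabla_algebra_scheme \<Rightarrow> ('b, 'n) nabla_algebra_scheme \<Rightarrow> ('a \<Rightarrow> 'b) \<Rightarrow> bool" where
  "nabla_hom A B f \<longleftrightarrow>
    (\<forall>a\<in>carrier A. f a \<in> carrier B) \<and>
    f \<bottom>\<^bsub>A\<^esub> = \<bottom>\<^bsub>B\<^esub> \<and>
    f \<top>\<^bsub>A\<^esub> = \<top>\<^bsub>B\<^esub> \<and>
    (\<forall>a\<in>carrier A. \<forall>b\<in>carrier A. f (a \<sqinter>\<^bsub>A\<^esub> b) = f a \<sqinter>\<^bsub>B\<^esub> f b) \<and>
    (\<forall>a\<in>carrier A. \<forall>b\<in>carrier A. f (a \<squnion>\<^bsub>A\<^esub> b) = f a \<squnion>\<^bsub>B\<^esub> f b) \<and>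
    (\<forall>a\<in>carrier A. f (nabla A a) = nabla B (f a)) \<and>
    (\<forall>a\<in>carrier A. \<forall>b\<in>carrier A. f (imp A a b) = imp B (f a) (f b))"

definition heyting_nabla_hom ::
  "('a, 'm) heyting_nabla_algebra_scheme \<Rightarrow> ('b, 'n) heyting_nabla_algebra_scheme
    \<Rightarrow> ('a \<Rightarrow> 'b) \<Rightarrow> bool" where
  "heyting_nabla_hom A B f \<longleftrightarrow>
    nabla_hom A B f \<and>
    (\<forall>a\<in>carrier A. \<forall>b\<in>carrier A. f (himp A a b) = himp B (f a) (f b))"

text \<open>
  In the following two definitions \<open>hom\<close> is the notion of morphism, so that they serve
  both for \<^const>\<open>nabla_hom\<close> and for \<^const>\<open>heyting_nabla_hom\<close>.

  The type \<open>'a\<close> is the universe from which the carriers of all algebras, including that of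
  the amalgam, are taken. A finite type is too small to be a reasonable universe, whereas
  the members of a triple of algebras of any size can be copied into a common infinite type.
\<close>

definition embedding ::
  "(('a, 'm) partial_object_scheme \<Rightarrow> ('b, 'n) partial_object_scheme \<Rightarrow> ('a \<Rightarrow> 'b) \<Rightarrow> bool)
    \<Rightarrow> ('a, 'm) partial_object_scheme \<Rightarrow> ('b, 'n) partial_object_scheme \<Rightarrow> ('a \<Rightarrow> 'b) \<Rightarrow> bool"
  where "embedding hom A B f \<longleftrightarrow> hom A B f \<and> inj_on f (carrier A)"

definition amalgamation_property ::
  "(('a, 'm) partial_object_scheme \<Rightarrow> ('a, 'm) partial_object_scheme \<Rightarrow> ('a \<Rightarrow> 'a) \<Rightarrow> bool)
    \<Rightarrow> ('a, 'm) partial_object_scheme set \<Rightarrow> bool"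
  where "amalgamation_property hom K \<longleftrightarrow>
    (\<forall>A0\<in>K. \<forall>A1\<in>K. \<forall>A2\<in>K. \<forall>f1 f2.
      embedding hom A0 A1 f1 \<and> embedding hom A0 A2 f2 \<longrightarrow>
      (\<exists>B\<in>K. \<exists>g1 g2. embedding hom A1 B g1 \<and> embedding hom A2 B g2 \<and>
        (\<forall>x\<in>carrier A0. g1 (f1 x) = g2 (f2 x))))"

end

theory Submission
  imports Defs
begin

text \<open>
  Under \<open>(D)\<close> and \<open>(N)\<close> the operation \<open>\<nabla>\<close> is a bounded lattice endomorphism, so its inverse image is a
  monotone map \<open>\<pi>\<close> on the poset of prime filters, and \<open>a \<rightarrow> b\<close> lies in \<open>x\<close> iff every prime
  filter \<open>y\<close> with \<open>x \<subseteq> \<pi> y\<close> and \<open>a \<in> y\<close> contains \<open>b\<close>. For embeddings \<open>A\<^sub>0 \<rightarrow> A\<^sub>1\<close> and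
  \<open>A\<^sub>0 \<rightarrow> A\<^sub>2\<close> let \<open>Z\<close> be the fibre product of the prime spectra of \<open>A\<^sub>1\<close> and \<open>A\<^sub>2\<close> over that of
  \<open>A\<^sub>0\<close>, with \<open>\<pi>\<close> and the order taken componentwise. The prime filter theorem yields
  surjectivity and the back condition for both projections of \<open>Z\<close>, hence \<open>A\<^sub>1\<close> and \<open>A\<^sub>2\<close> embed
  into the algebra of up-sets of \<open>Z\<close>. The conditions \<open>(R)\<close>, \<open>(L)\<close> and \<open>(Fa)\<close> say that
  \<open>x \<subseteq> \<pi> x\<close>, that \<open>\<pi> x \<subseteq> x\<close> and that \<open>\<pi>\<close> reflects the order, and these pass to \<open>Z\<close>. Since
  the algebra of all up-sets may be too large for the given universe, the amalgam is the
  subalgebra generated by the images of \<open>A\<^sub>1\<close> and \<open>A\<^sub>2\<close>; it satisfies \<open>(Fa)\<close> because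
  \<open>U = \<nabla> (1 \<rightarrow> U)\<close> holds for every up-set \<open>U\<close>.
\<close>

section \<open>Prime filters\<close>

(* As classical rules these and the order rules removed below let blast and auto run forever. *)
declare least_closed [rule del] greatest_closed [rule del]

locale distributive_lattice = bounded_lattice L for L (structure) +
  assumes meet_join_distrib:
    "\<lbrakk>a \<in> carrier L; b \<in> carrier L; c \<in> carrier L\<rbrakk>
      \<Longrightarrow> a \<sqinter> (b \<squnion> c) = (a \<sqinter> b) \<squnion> (a \<sqinter> c)"

text \<open>The prime filters, given as the sets whose characteristic function is a bounded lattice
  homomorphism to the two-element lattice. Upward closure is contained in the equivalence for
  meets.\<close>

definition spec :: "('a, 'm) gorder_scheme \<Rightarrow> 'a set set" where
  "spec L = {P. P \<subseteq> carrier L \<and> \<top>\<^bsub>L\<^esub> \<in> P \<and> \<bottom>\<^bsub>L\<^esub> \<notin> P \<and>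
    (\<forall>a\<in>carrier L. \<forall>b\<in>carrier L.
      (a \<sqinter>\<^bsub>L\<^esub> b \<in> P \<longleftrightarrow> a \<in> P \<and> b \<in> P) \<and> (a \<squnion>\<^bsub>L\<^esub> b \<in> P \<longleftrightarrow> a \<in> P \<or> b \<in> P))}"

text \<open>Inverse image, cut down to the carrier because \<open>f\<close> is unconstrained outside
  it. It serves both as the restriction of prime filters along an embedding and as the map \<pi>
  that belongs to \<open>nabla\<close>.\<close>

definition pre :: "('a, 'm) gorder_scheme \<Rightarrow> ('a \<Rightarrow> 'b) \<Rightarrow> 'b set \<Rightarrow> 'a set" where
  "pre L f P = {a \<in> carrier L. f a \<in> P}"

text \<open>Only the bounded lattice structure is kept, so that the notion covers the embeddings as
  well as the operator \<open>n\<close> of an adjoint lattice.\<close>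

definition lattice_hom ::
  "('a, 'm) gorder_scheme \<Rightarrow> ('b, 'n) gorder_scheme \<Rightarrow> ('a \<Rightarrow> 'b) \<Rightarrow> bool" where
  "lattice_hom L M f \<longleftrightarrow>
    (\<forall>a\<in>carrier L. f a \<in> carrier M) \<and>
    f \<bottom>\<^bsub>L\<^esub> = \<bottom>\<^bsub>M\<^esub> \<and> f \<top>\<^bsub>L\<^esub> = \<top>\<^bsub>M\<^esub> \<and>
    (\<forall>a\<in>carrier L. \<forall>b\<in>carrier L. f (a \<sqinter>\<^bsub>L\<^esub> b) = f a \<sqinter>\<^bsub>M\<^esub> f b \<and> f (a \<squnion>\<^bsub>L\<^esub> b) = f a \<squnion>\<^bsub>M\<^esub> f b)"

lemma spec_carrier: "P \<in> spec L \<Longrightarrow> a \<in> P \<Longrightarrow> a \<in> carrier L"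
  by (auto simp: spec_def)

lemma spec_top: "P \<in> spec L \<Longrightarrow> \<top>\<^bsub>L\<^esub> \<in> P"
  by (auto simp: spec_def)

lemma spec_bottom: "P \<in> spec L \<Longrightarrow> \<bottom>\<^bsub>L\<^esub> \<notin> P"
  by (auto simp: spec_def)

lemma spec_meet:
  "\<lbrakk>P \<in> spec L; a \<in> carrier L; b \<in> carrier L\<rbrakk> \<Longrightarrow> a \<sqinter>\<^bsub>L\<^esub> b \<in> P \<longleftrightarrow> a \<in> P \<and> b \<in> P"
  by (auto simp: spec_def)

lemma spec_join:
  "\<lbrakk>P \<in> spec L; a \<in> carrier L; b \<in> carrier L\<rbrakk> \<Longrightarrow> a \<squnion>\<^bsub>L\<^esub> b \<in> P \<longleftrightarrow> a \<in> P \<or> b \<in> P"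
  by (auto simp: spec_def)

section \<open>Order calculus in bounded lattices\<close>

context bounded_lattice
begin

declare le_antisym [rule del] le_cong_l [rule del] le_cong_r [rule del] weak_refl [rule del]

lemma meet_leI1:
  assumes "a \<sqsubseteq> c" "a \<in> carrier L" "b \<in> carrier L" "c \<in> carrier L"
  shows "a \<sqinter> b \<sqsubseteq> c"
  by (rule le_trans[OF meet_left]) (use assms in auto)

lemma meet_leI2:
  assumes "b \<sqsubseteq> c" "a \<in> carrier L" "b \<in> carrier L" "c \<in> carrier L"
  shows "a \<sqinter> b \<sqsubseteq> c"
  by (rule le_trans[OF meet_right]) (use assms in auto)

lemma le_meet_iff:
  assumes "a \<in> carrier L" "b \<in> carrier L" "c \<in> carrier L"
  shows "c \<sqsubseteq> a \<sqinter> b \<longleftrightarrow> c \<sqsubseteq> a \<and> c \<sqsubseteq> b"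
proof
  assume c: "c \<sqsubseteq> a \<sqinter> b"
  show "c \<sqsubseteq> a \<and> c \<sqsubseteq> b"
    using le_trans[OF c meet_left] le_trans[OF c meet_right] assms by simp
qed (use assms meet_le in blast)

lemma le_joinI1:
  assumes "c \<sqsubseteq> a" "a \<in> carrier L" "b \<in> carrier L" "c \<in> carrier L"
  shows "c \<sqsubseteq> a \<squnion> b"
  by (rule le_trans[OF assms(1) join_left]) (use assms in auto)

lemma le_joinI2:
  assumes "c \<sqsubseteq> b" "a \<in> carrier L" "b \<in> carrier L" "c \<in> carrier L"
  shows "c \<sqsubseteq> a \<squnion> b"
  by (rule le_trans[OF assms(1) join_right]) (use assms in auto)

lemma join_le_iff:
  assumes "a \<in> carrier L" "b \<in> carrier L" "c \<in> carrier L"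
  shows "a \<squnion> b \<sqsubseteq> c \<longleftrightarrow> a \<sqsubseteq> c \<and> b \<sqsubseteq> c"
proof
  assume c: "a \<squnion> b \<sqsubseteq> c"
  show "a \<sqsubseteq> c \<and> b \<sqsubseteq> c"
    using le_trans[OF join_left c] le_trans[OF join_right c] assms by simp
qed (use assms join_le in blast)

lemma meet_absorb: "\<lbrakk>a \<sqsubseteq> b; a \<in> carrier L; b \<in> carrier L\<rbrakk> \<Longrightarrow> a \<sqinter> b = a"
  by (rule iffD1[OF le_iff_join, symmetric])

lemma join_absorb: "\<lbrakk>a \<sqsubseteq> b; a \<in> carrier L; b \<in> carrier L\<rbrakk> \<Longrightarrow> a \<squnion> b = b"
  by (rule iffD1[OF le_iff_meet])

lemmas meet_order = le_meet_iff meet_leI1 meet_leI2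

end

lemma (in bounded_lattice) spec_up:
  assumes P: "P \<in> spec L" and "a \<in> P" "a \<sqsubseteq> b" "b \<in> carrier L"
  shows "b \<in> P"
proof -
  have "a \<in> carrier L" using assms(1,2) by (rule spec_carrier)
  then have "a \<sqinter> b = a" by (rule meet_absorb[OF assms(3) _ assms(4)])
  then show ?thesis using spec_meet[OF P, of a b] assms \<open>a \<in> carrier L\<close> by simp
qed

text \<open>For the Heyting implication the operator is the identity, and this makes the induced map
  on prime filters the identity too.\<close>

lemma pre_id: "P \<in> spec L \<Longrightarrow> pre L (\<lambda>a. a) P = P"
  by (auto simp: spec_def pre_def)

lemma pre_spec:
  assumes "bounded_lattice L" "lattice_hom L M f" "P \<in> spec M"
  shows "pre L f P \<in> spec L"
proof -
  interpret bounded_lattice L by fact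
  show ?thesis
    using assms(2,3) unfolding lattice_hom_def by (simp add: spec_def pre_def subset_iff)
qed

text \<open>\<open>F\<close> and \<open>I\<close> are bases of a filter and an ideal, which is why
  they are separated through the order. Zorn's lemma gives a maximal \<open>M\<close> among the
  meet-closed sets that contain \<open>F\<close> and have no element below one of \<open>I\<close>.
  Maximality makes \<open>M\<close> upward closed and, together with distributivity, prime.\<close>

lemma (in distributive_lattice) prime_filter_exists:
  assumes F: "F \<subseteq> carrier L" "F \<noteq> {}" "\<And>a b. \<lbrakk>a \<in> F; b \<in> F\<rbrakk> \<Longrightarrow> a \<sqinter> b \<in> F"
    and I: "I \<subseteq> carrier L" "I \<noteq> {}" "\<And>a b. \<lbrakk>a \<in> I; b \<in> I\<rbrakk> \<Longrightarrow> a \<squnion> b \<in> I"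
    and sep: "\<And>a b. \<lbrakk>a \<in> F; b \<in> I\<rbrakk> \<Longrightarrow> \<not> a \<sqsubseteq> b"
  obtains P where "P \<in> spec L" "F \<subseteq> P" "P \<inter> I = {}"
proof -
  define \<A> where "\<A> = {G. F \<subseteq> G \<and> G \<subseteq> carrier L \<and> (\<forall>a\<in>G. \<forall>b\<in>G. a \<sqinter> b \<in> G) \<and>
    (\<forall>a\<in>G. \<forall>b\<in>I. \<not> a \<sqsubseteq> b)}"
  have "\<exists>M\<in>\<A>. \<forall>X\<in>\<A>. M \<subseteq> X \<longrightarrow> X = M"
  proof (rule subset_Zorn_nonempty)
    have "F \<in> \<A>" unfolding \<A>_def using F sep by simp
    then show "\<A> \<noteq> {}" by auto
  next
    fix \<C> assume ne: "\<C> \<noteq> {}" and ch: "subset.chain \<A> \<C>"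
    have sub: "\<C> \<subseteq> \<A>" and lin: "\<And>X Y. X \<in> \<C> \<Longrightarrow> Y \<in> \<C> \<Longrightarrow> X \<subseteq> Y \<or> Y \<subseteq> X"
      using ch unfolding subset.chain_def by blast+
    have "a \<sqinter> b \<in> \<Union>\<C>" if ab: "a \<in> \<Union>\<C>" "b \<in> \<Union>\<C>" for a b
    proof -
      obtain X Y where XY: "X \<in> \<C>" "Y \<in> \<C>" "a \<in> X" "b \<in> Y" using ab by blast
      then obtain W where "W \<in> \<C>" "a \<in> W" "b \<in> W" using lin[of X Y] by blast
      then show ?thesis using sub unfolding \<A>_def by blast
    qed
    moreover have "F \<subseteq> \<Union>\<C>" "\<Union>\<C> \<subseteq> carrier L" "\<forall>a\<in>\<Union>\<C>. \<forall>b\<in>I. \<not> a \<sqsubseteq> b"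
      using ne sub unfolding \<A>_def by blast+
    ultimately show "\<Union>\<C> \<in> \<A>" unfolding \<A>_def by blast
  qed
  then obtain M where M: "M \<in> \<A>" and max: "\<And>X. X \<in> \<A> \<Longrightarrow> M \<subseteq> X \<Longrightarrow> X = M" by blast
  have FM: "F \<subseteq> M" and Mc: "\<And>a. a \<in> M \<Longrightarrow> a \<in> carrier L"
    and Mm: "\<And>a b. \<lbrakk>a \<in> M; b \<in> M\<rbrakk> \<Longrightarrow> a \<sqinter> b \<in> M"
    and MI: "\<And>a b. \<lbrakk>a \<in> M; b \<in> I\<rbrakk> \<Longrightarrow> \<not> a \<sqsubseteq> b"
    using M unfolding \<A>_def by auto
  have Ic: "\<And>a. a \<in> I \<Longrightarrow> a \<in> carrier L" using I by blast
  obtain m0 where m0: "m0 \<in> M" using F FM by blast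
  obtain i0 where i0: "i0 \<in> I" using I by blast
  \<comment> \<open>Otherwise the filter \<open>G\<close> generated by \<open>M\<close> and
    \<open>x\<close> would still belong to \<open>\<A>\<close>, against maximality.\<close>
  have key: "\<exists>m\<in>M. \<exists>i\<in>I. m \<sqinter> x \<sqsubseteq> i" if x: "x \<in> carrier L" "x \<notin> M" for x
  proof (rule ccontr)
    assume no: "\<not> ?thesis"
    define G where "G = {g \<in> carrier L. \<exists>m\<in>M. m \<sqinter> x \<sqsubseteq> g}"
    have "M \<subseteq> G" unfolding G_def using Mc x meet_left by blast
    moreover have "x \<in> G" unfolding G_def using m0 Mc x meet_right by blast
    moreover have "a \<sqinter> b \<in> G" if ab: "a \<in> G" "b \<in> G" for a b
    proof -
      obtain m k where mk: "m \<in> M" "m \<sqinter> x \<sqsubseteq> a" "k \<in> M" "k \<sqinter> x \<sqsubseteq> b"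
        and c: "a \<in> carrier L" "b \<in> carrier L"
        using ab unfolding G_def by blast
      note cc = mk(1,3)[THEN Mc] c x(1)
      have "(m \<sqinter> k) \<sqinter> x \<sqsubseteq> m \<sqinter> x" "(m \<sqinter> k) \<sqinter> x \<sqsubseteq> k \<sqinter> x"
        using cc by (simp_all add: meet_order)
      then have "(m \<sqinter> k) \<sqinter> x \<sqsubseteq> a \<sqinter> b"
        using cc le_trans[OF _ mk(2)] le_trans[OF _ mk(4)] by (simp add: le_meet_iff)
      then show ?thesis unfolding G_def using Mm[OF mk(1,3)] cc by auto
    qed
    moreover have "\<not> a \<sqsubseteq> b" if ab: "a \<in> G" "b \<in> I" for a b
    proof
      assume "a \<sqsubseteq> b"
      obtain m where m: "m \<in> M" "m \<sqinter> x \<sqsubseteq> a" "a \<in> carrier L" using ab unfolding G_def by blast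
      then have "m \<sqinter> x \<sqsubseteq> b"
        using le_trans[OF m(2) \<open>a \<sqsubseteq> b\<close>] x Mc Ic ab by simp
      then show False using no m ab by blast
    qed
    moreover have "G \<subseteq> carrier L" by (auto simp: G_def)
    ultimately have "G \<in> \<A>" unfolding \<A>_def using FM by simp
    then have "G = M" using max \<open>M \<subseteq> G\<close> by blast
    then show False using \<open>x \<in> G\<close> x by blast
  qed
  \<comment> \<open>If \<open>x\<close> were missing, \<open>key\<close> would put some
    \<open>k \<sqinter> x\<close> below an element of \<open>I\<close>, and with it
    \<open>k \<sqinter> m\<close>, which lies in \<open>M\<close>.\<close>
  have up: "x \<in> M" if mx: "m \<in> M" "m \<sqsubseteq> x" "x \<in> carrier L" for m x
  proof (rule ccontr)
    assume "x \<notin> M"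
    then obtain k i where ki: "k \<in> M" "i \<in> I" "k \<sqinter> x \<sqsubseteq> i" using key mx by blast
    have "k \<sqinter> m \<sqsubseteq> k \<sqinter> x"
      using that ki Mc by (simp add: meet_order)
    then have "k \<sqinter> m \<sqsubseteq> i" using le_trans[OF _ ki(3)] ki that Mc Ic by simp
    then show False using MI Mm ki that by blast
  qed
  have "\<top> \<in> M" using up[OF m0] Mc[OF m0] by (simp add: top_higher top_closed)
  moreover have "\<bottom> \<notin> M" using MI[OF _ i0] Ic[OF i0] bottom_lower by blast
  moreover have "a \<sqinter> b \<in> M \<longleftrightarrow> a \<in> M \<and> b \<in> M" if "a \<in> carrier L" "b \<in> carrier L" for a b
    using that up[of "a \<sqinter> b"] Mm meet_left[of a b] meet_right[of a b] by blast
  moreover have "a \<squnion> b \<in> M \<longleftrightarrow> a \<in> M \<or> b \<in> M" if ab: "a \<in> carrier L" "b \<in> carrier L" for a b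
  proof
    assume j: "a \<squnion> b \<in> M"
    show "a \<in> M \<or> b \<in> M"
    proof (rule ccontr)
      assume "\<not> ?thesis"
      then obtain m i k l where *: "m \<in> M" "i \<in> I" "m \<sqinter> a \<sqsubseteq> i" "k \<in> M" "l \<in> I" "k \<sqinter> b \<sqsubseteq> l"
        using key ab by meson
      note cc = *(1,4)[THEN Mc] *(2,5)[THEN Ic] ab
      \<comment> \<open>The common factor \<open>m \<sqinter> k\<close> works for both
        \<open>a\<close> and \<open>b\<close>, so distributivity will place an element of
        \<open>M\<close> below \<open>i \<squnion> l\<close>.\<close>
      have "(m \<sqinter> k) \<sqinter> a \<sqsubseteq> m \<sqinter> a" "(m \<sqinter> k) \<sqinter> b \<sqsubseteq> k \<sqinter> b"
        using cc by (simp_all add: meet_order)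
      then have "(m \<sqinter> k) \<sqinter> a \<sqsubseteq> i" "(m \<sqinter> k) \<sqinter> b \<sqsubseteq> l"
        using le_trans[OF _ *(3)] le_trans[OF _ *(6)] cc by simp_all
      then have "(m \<sqinter> k) \<sqinter> a \<sqsubseteq> i \<squnion> l" "(m \<sqinter> k) \<sqinter> b \<sqsubseteq> i \<squnion> l"
        using cc by (simp_all add: le_joinI1 le_joinI2)
      then have "(m \<sqinter> k) \<sqinter> (a \<squnion> b) \<sqsubseteq> i \<squnion> l"
        using cc by (simp add: meet_join_distrib join_le_iff)
      then show False using MI[of "(m \<sqinter> k) \<sqinter> (a \<squnion> b)" "i \<squnion> l"] Mm * j I by simp
    qed
  next
    assume "a \<in> M \<or> b \<in> M"
    then show "a \<squnion> b \<in> M" using ab up[of _ "a \<squnion> b"] join_left[of a b] join_right[of a b] by auto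
  qed
  ultimately have "M \<in> spec L" unfolding spec_def using Mc by (simp add: subset_iff)
  moreover have "M \<inter> I = {}" using MI le_refl[OF Mc] by blast
  ultimately show ?thesis using that FM by blast
qed

section \<open>Left adjoint operators and prime filters\<close>

text \<open>
  Taking \<open>n\<close> to be either \<open>\<nabla>\<close> or the identity treats \<open>\<rightarrow>\<close> and \<open>\<supset>\<close> uniformly.
\<close>

locale adjoint_lattice = distributive_lattice L for L (structure) +
  fixes n :: "'a \<Rightarrow> 'a" and j :: "'a \<Rightarrow> 'a \<Rightarrow> 'a"
  assumes n_closed: "a \<in> carrier L \<Longrightarrow> n a \<in> carrier L"
    and j_closed: "\<lbrakk>a \<in> carrier L; b \<in> carrier L\<rbrakk> \<Longrightarrow> j a b \<in> carrier L"
    and n_top: "n \<top> = \<top>"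
    and n_meet: "\<lbrakk>a \<in> carrier L; b \<in> carrier L\<rbrakk> \<Longrightarrow> n (a \<sqinter> b) = n a \<sqinter> n b"
    and adjoint: "\<lbrakk>a \<in> carrier L; b \<in> carrier L; c \<in> carrier L\<rbrakk> \<Longrightarrow> n c \<sqinter> a \<sqsubseteq> b \<longleftrightarrow> c \<sqsubseteq> j a b"
begin

lemma n_mono: "\<lbrakk>a \<in> carrier L; b \<in> carrier L; a \<sqsubseteq> b\<rbrakk> \<Longrightarrow> n a \<sqsubseteq> n b"
  using n_meet[of a b] meet_right[of "n a" "n b"] meet_absorb[of a b] n_closed by simp

text \<open>Taking \<open>\<top>\<close> as first argument of the implication exhibits
  \<open>n\<close> as a left adjoint. This is why \<open>n\<close> preserves
  \<open>\<bottom>\<close> and joins, and hence why its inverse image maps prime filters to prime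
  filters.\<close>

lemma n_adjoint_top:
  assumes "a \<in> carrier L" "b \<in> carrier L"
  shows "n a \<sqsubseteq> b \<longleftrightarrow> a \<sqsubseteq> j \<top> b"
proof -
  have "n a \<sqinter> \<top> = n a" using assms n_closed by (simp add: meet_absorb top_closed top_higher)
  then show ?thesis using adjoint[of \<top> b a] assms top_closed by simp
qed

lemma n_bottom: "n \<bottom> = \<bottom>"
proof (rule le_antisym)
  show "n \<bottom> \<sqsubseteq> \<bottom>"
    using n_adjoint_top[of \<bottom> \<bottom>] bottom_lower[of "j \<top> \<bottom>"] j_closed bottom_closed top_closed by simp
qed (use n_closed bottom_closed bottom_lower in simp_all)

lemma n_join:
  assumes ab: "a \<in> carrier L" "b \<in> carrier L"
  shows "n (a \<squnion> b) = n a \<squnion> n b"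
proof (rule le_antisym)
  have "a \<sqsubseteq> j \<top> (n a \<squnion> n b)" "b \<sqsubseteq> j \<top> (n a \<squnion> n b)"
    using ab n_closed by (simp_all add: n_adjoint_top[symmetric] join_left join_right)
  then have "a \<squnion> b \<sqsubseteq> j \<top> (n a \<squnion> n b)"
    using ab n_closed j_closed top_closed by (simp add: join_le_iff)
  then show "n (a \<squnion> b) \<sqsubseteq> n a \<squnion> n b" using ab n_closed by (simp add: n_adjoint_top)
  show "n a \<squnion> n b \<sqsubseteq> n (a \<squnion> b)"
    using ab n_closed n_mono join_left join_right by (simp add: join_le_iff)
qed (use ab n_closed in simp_all)

lemma n_hom: "lattice_hom L L n"
  unfolding lattice_hom_def by (simp add: n_closed n_top n_bottom n_meet n_join)

lemma spec_n: "P \<in> spec L \<Longrightarrow> pre L n P \<in> spec L"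
  by (rule pre_spec[OF bounded_lattice_axioms n_hom])

lemma modus_ponens:
  assumes "a \<in> carrier L" "b \<in> carrier L"
  shows "n (j a b) \<sqinter> a \<sqsubseteq> b"
  using assms adjoint[of a b "j a b"] j_closed by simp

text \<open>The elements \<open>n c \<sqinter> d\<close> with \<open>c\<close> in \<open>P\<close>
  and \<open>d\<close> in \<open>D\<close> are closed under meets, since \<open>n\<close> preserves
  them. None lies below an \<open>e\<close> in \<open>E\<close>: by adjointness
  \<open>c \<sqsubseteq> j d e\<close>, so \<open>j d e\<close> would be in \<open>P\<close>. A
  prime filter separating the two sets is the required \<open>Q\<close>. Singletons for
  \<open>D\<close> and \<open>E\<close> give \<open>spec_imp\<close>; images of a prime filter and
  of its complement give \<open>spec_lift\<close>.\<close>

lemma spec_extension: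
  assumes P: "P \<in> spec L"
    and D: "D \<subseteq> carrier L" "D \<noteq> {}" "\<And>a b. \<lbrakk>a \<in> D; b \<in> D\<rbrakk> \<Longrightarrow> a \<sqinter> b \<in> D"
    and E: "E \<subseteq> carrier L" "E \<noteq> {}" "\<And>a b. \<lbrakk>a \<in> E; b \<in> E\<rbrakk> \<Longrightarrow> a \<squnion> b \<in> E"
    and sep: "\<And>d e. \<lbrakk>d \<in> D; e \<in> E\<rbrakk> \<Longrightarrow> j d e \<notin> P"
  obtains Q where "Q \<in> spec L" "P \<subseteq> pre L n Q" "D \<subseteq> Q" "Q \<inter> E = {}"
proof -
  have Pc: "\<And>c. c \<in> P \<Longrightarrow> c \<in> carrier L" using spec_carrier[OF P] .
  have Dc: "\<And>c. c \<in> D \<Longrightarrow> c \<in> carrier L" and Ec: "\<And>c. c \<in> E \<Longrightarrow> c \<in> carrier L"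
    using D(1) E(1) by (simp_all add: subset_iff)
  define F where "F = {n c \<sqinter> d | c d. c \<in> P \<and> d \<in> D}"
  have Fc: "F \<subseteq> carrier L" unfolding F_def using Pc Dc n_closed by auto
  have F_ne: "F \<noteq> {}" unfolding F_def using D(2) spec_top[OF P] by blast
  have F_meet: "x \<sqinter> y \<in> F" if "x \<in> F" "y \<in> F" for x y
  proof -
    obtain c d c' d' where *: "x = n c \<sqinter> d" "y = n c' \<sqinter> d'" "c \<in> P" "c' \<in> P" "d \<in> D" "d' \<in> D"
      using \<open>x \<in> F\<close> \<open>y \<in> F\<close> unfolding F_def by blast
    note cc = *(3,4)[THEN Pc] *(3,4)[THEN Pc, THEN n_closed] *(5,6)[THEN Dc]
    have "x \<sqinter> y = n (c \<sqinter> c') \<sqinter> (d \<sqinter> d')"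
    proof (rule le_antisym)
      show "x \<sqinter> y \<sqsubseteq> n (c \<sqinter> c') \<sqinter> (d \<sqinter> d')"
        unfolding * n_meet[OF cc(1,2)] using cc
        by (simp add: meet_order)
      show "n (c \<sqinter> c') \<sqinter> (d \<sqinter> d') \<sqsubseteq> x \<sqinter> y"
        unfolding * n_meet[OF cc(1,2)] using cc
        by (simp add: meet_order)
    qed (use cc * n_closed in simp_all)
    moreover have "c \<sqinter> c' \<in> P" "d \<sqinter> d' \<in> D" using * cc spec_meet[OF P] D(3) by simp_all
    ultimately show ?thesis unfolding F_def by blast
  qed
  have FE: "\<not> x \<sqsubseteq> e" if xe: "x \<in> F" "e \<in> E" for x e
  proof
    assume "x \<sqsubseteq> e"
    obtain c d where *: "x = n c \<sqinter> d" "c \<in> P" "d \<in> D" using xe unfolding F_def by blast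
    then have "c \<sqsubseteq> j d e" using \<open>x \<sqsubseteq> e\<close> adjoint[of d e c] Pc Dc Ec xe by simp
    then have "j d e \<in> P" using spec_up[OF P] * Dc Ec xe j_closed by simp
    then show False using sep * xe by blast
  qed
  obtain Q where Q: "Q \<in> spec L" "F \<subseteq> Q" "Q \<inter> E = {}"
    by (rule prime_filter_exists[OF Fc F_ne F_meet E FE])
  have *: "n c \<in> Q \<and> d \<in> Q" if "c \<in> P" "d \<in> D" for c d
  proof -
    have "n c \<sqinter> d \<in> Q" using Q that unfolding F_def by blast
    then show ?thesis using spec_meet[OF Q(1)] that Pc Dc n_closed by simp
  qed
  \<comment> \<open>The first inclusion pairs \<open>c\<close> with any element of \<open>D\<close>,
    the second pairs \<open>d\<close> with \<open>\<top>\<close> in \<open>P\<close>.\<close>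
  then have "P \<subseteq> pre L n Q" "D \<subseteq> Q"
    using Pc D(2) spec_top[OF P] unfolding pre_def by blast+
  then show ?thesis using that Q by blast
qed

text \<open>This is the Kripke clause for the implication. One direction is modus ponens inside
  \<open>Q\<close>; for the other, a missing \<open>j a b\<close> allows
  \<open>spec_extension\<close> to produce a \<open>Q\<close> with \<open>a\<close> but without
  \<open>b\<close>.\<close>

lemma spec_imp:
  assumes P: "P \<in> spec L" and ab: "a \<in> carrier L" "b \<in> carrier L"
  shows "j a b \<in> P \<longleftrightarrow> (\<forall>Q\<in>spec L. P \<subseteq> pre L n Q \<and> a \<in> Q \<longrightarrow> b \<in> Q)"
proof (intro iffI ballI impI)
  fix Q assume "j a b \<in> P" and Q: "Q \<in> spec L" and "P \<subseteq> pre L n Q \<and> a \<in> Q"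
  then have "n (j a b) \<sqinter> a \<in> Q" using ab n_closed j_closed by (auto simp: pre_def spec_meet)
  then show "b \<in> Q" using spec_up[OF Q _ modus_ponens] ab by blast
next
  assume R: "\<forall>Q\<in>spec L. P \<subseteq> pre L n Q \<and> a \<in> Q \<longrightarrow> b \<in> Q"
  show "j a b \<in> P"
  proof (rule ccontr)
    assume no: "j a b \<notin> P"
    have "a \<sqinter> a = a" "b \<squnion> b = b"
      using ab by (simp_all add: meet_absorb join_absorb)
    with no ab obtain Q where "Q \<in> spec L" "P \<subseteq> pre L n Q" "{a} \<subseteq> Q" "Q \<inter> {b} = {}"
      by (rule_tac spec_extension[OF P, of "{a}" "{b}"]) simp_all
    then show False using R by blast
  qed
qed

end

section \<open>Lifting prime filters along homomorphisms\<close>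

lemma spec_image:
  assumes "bounded_lattice L0" and f: "lattice_hom L0 L f" and z: "z \<in> spec L0"
  shows "f ` z \<subseteq> carrier L" "f ` z \<noteq> {}" "\<And>a b. \<lbrakk>a \<in> f ` z; b \<in> f ` z\<rbrakk> \<Longrightarrow> a \<sqinter>\<^bsub>L\<^esub> b \<in> f ` z"
    "f ` (carrier L0 - z) \<subseteq> carrier L" "f ` (carrier L0 - z) \<noteq> {}"
    "\<And>a b. \<lbrakk>a \<in> f ` (carrier L0 - z); b \<in> f ` (carrier L0 - z)\<rbrakk> \<Longrightarrow> a \<squnion>\<^bsub>L\<^esub> b \<in> f ` (carrier L0 - z)"
proof -
  interpret L0: bounded_lattice L0 by fact
  have zc: "\<And>a. a \<in> z \<Longrightarrow> a \<in> carrier L0" using spec_carrier[OF z] .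
  have fc: "\<And>a. a \<in> carrier L0 \<Longrightarrow> f a \<in> carrier L" using f by (auto simp: lattice_hom_def)
  show "f ` z \<subseteq> carrier L" "f ` (carrier L0 - z) \<subseteq> carrier L" using fc zc by auto
  show "f ` z \<noteq> {}" "f ` (carrier L0 - z) \<noteq> {}"
    using spec_top[OF z] spec_bottom[OF z] L0.bottom_closed by auto
  show "a \<sqinter>\<^bsub>L\<^esub> b \<in> f ` z" if ab: "a \<in> f ` z" "b \<in> f ` z" for a b
  proof -
    obtain c d where cd: "a = f c" "b = f d" "c \<in> z" "d \<in> z" using ab by blast
    then have "f (c \<sqinter>\<^bsub>L0\<^esub> d) = a \<sqinter>\<^bsub>L\<^esub> b" "c \<sqinter>\<^bsub>L0\<^esub> d \<in> z"
      using f zc spec_meet[OF z] unfolding lattice_hom_def by auto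
    then show ?thesis by (metis imageI)
  qed
  \<comment> \<open>The complement of \<open>z\<close> is closed under joins because
    \<open>z\<close> is prime.\<close>
  show "a \<squnion>\<^bsub>L\<^esub> b \<in> f ` (carrier L0 - z)"
    if ab: "a \<in> f ` (carrier L0 - z)" "b \<in> f ` (carrier L0 - z)" for a b
  proof -
    obtain c d where cd: "a = f c" "b = f d" "c \<in> carrier L0 - z" "d \<in> carrier L0 - z"
      using ab by blast
    then have "f (c \<squnion>\<^bsub>L0\<^esub> d) = a \<squnion>\<^bsub>L\<^esub> b" "c \<squnion>\<^bsub>L0\<^esub> d \<in> carrier L0 - z"
      using f spec_join[OF z] unfolding lattice_hom_def by auto
    then show ?thesis by (metis imageI)
  qed
qed

lemma spec_lift:
  assumes "adjoint_lattice L0 n0 j0" "adjoint_lattice L n j" and f: "lattice_hom L0 L f"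
    and fj: "\<And>a b. \<lbrakk>a \<in> carrier L0; b \<in> carrier L0\<rbrakk> \<Longrightarrow> f (j0 a b) = j (f a) (f b)"
    and y: "y \<in> spec L" and z: "z \<in> spec L0" and sub: "pre L0 f y \<subseteq> pre L0 n0 z"
  obtains w where "w \<in> spec L" "pre L0 f w = z" "y \<subseteq> pre L n w"
proof -
  interpret L0: adjoint_lattice L0 n0 j0 by fact
  interpret L: adjoint_lattice L n j by fact
  have zc: "\<And>a. a \<in> z \<Longrightarrow> a \<in> carrier L0" using spec_carrier[OF z] .
  have sep: "j d e \<notin> y" if de: "d \<in> f ` z" "e \<in> f ` (carrier L0 - z)" for d e
  proof
    assume jy: "j d e \<in> y"
    obtain a b where ab: "d = f a" "e = f b" "a \<in> z" "b \<in> carrier L0" "b \<notin> z"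
      using de by blast
    then have "f (j0 a b) \<in> y" using jy fj zc by simp
    then have "j0 a b \<in> pre L0 f y" using ab zc L0.j_closed by (simp add: pre_def)
    then have "n0 (j0 a b) \<in> z" using sub by (auto simp: pre_def)
    then have "n0 (j0 a b) \<sqinter>\<^bsub>L0\<^esub> a \<in> z"
      using ab zc L0.n_closed L0.j_closed spec_meet[OF z] by auto
    then have "b \<in> z" using L0.spec_up[OF z _ L0.modus_ponens] ab zc by blast
    then show False using ab by blast
  qed
  obtain w where w: "w \<in> spec L" "y \<subseteq> pre L n w" "f ` z \<subseteq> w" "w \<inter> f ` (carrier L0 - z) = {}"
    by (rule L.spec_extension[OF y spec_image[OF L0.bounded_lattice_axioms f z] sep])
  have "pre L0 f w = z" using w zc by (auto simp: pre_def)
  then show ?thesis using that w by blast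
qed

text \<open>An injective homomorphism reflects the order, so the image of \<open>z\<close> and that
  of its complement can be separated by a prime filter, which then restricts to
  \<open>z\<close>.\<close>

lemma spec_surj:
  assumes "bounded_lattice L0" "distributive_lattice L" and f: "lattice_hom L0 L f"
    and inj: "inj_on f (carrier L0)" and z: "z \<in> spec L0"
  obtains w where "w \<in> spec L" "pre L0 f w = z"
proof -
  interpret L0: bounded_lattice L0 by fact
  interpret L: distributive_lattice L by fact
  have zc: "\<And>a. a \<in> z \<Longrightarrow> a \<in> carrier L0" using spec_carrier[OF z] .
  have fc: "\<And>a. a \<in> carrier L0 \<Longrightarrow> f a \<in> carrier L" using f by (auto simp: lattice_hom_def)
  have sep: "\<not> d \<sqsubseteq>\<^bsub>L\<^esub> e" if de: "d \<in> f ` z" "e \<in> f ` (carrier L0 - z)" for d e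
  proof
    assume le: "d \<sqsubseteq>\<^bsub>L\<^esub> e"
    obtain a b where ab: "d = f a" "e = f b" "a \<in> z" "b \<in> carrier L0" "b \<notin> z"
      using de by blast
    then have "f a = f (a \<sqinter>\<^bsub>L0\<^esub> b)"
      using L.meet_absorb[OF le] fc zc f unfolding lattice_hom_def by simp
    then have "a = a \<sqinter>\<^bsub>L0\<^esub> b" using inj ab zc L0.meet_closed by (meson inj_onD)
    then have "b \<in> z" using spec_meet[OF z, of a b] ab zc by simp
    then show False using ab by blast
  qed
  obtain w where w: "w \<in> spec L" "f ` z \<subseteq> w" "w \<inter> f ` (carrier L0 - z) = {}"
    by (rule L.prime_filter_exists[OF spec_image[OF L0.bounded_lattice_axioms f z] sep])
  have "pre L0 f w = z" using w zc by (auto simp: pre_def)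
  then show ?thesis using that w by blast
qed

section \<open>The conditions (R), (L) and (Fa) on the prime spectrum\<close>

context adjoint_lattice
begin

lemma spec_increasing:
  assumes "\<And>a. a \<in> carrier L \<Longrightarrow> a \<sqsubseteq> n a" "P \<in> spec L"
  shows "P \<subseteq> pre L n P"
proof
  fix a assume "a \<in> P"
  then show "a \<in> pre L n P"
    using assms(1)[of a] spec_carrier[OF assms(2), of a] spec_up[OF assms(2), of a "n a"] n_closed[of a]
    by (simp add: pre_def)
qed

lemma spec_decreasing:
  assumes "\<And>a. a \<in> carrier L \<Longrightarrow> n a \<sqsubseteq> a" "P \<in> spec L"
  shows "pre L n P \<subseteq> P"
proof
  fix a assume "a \<in> pre L n P"
  then show "a \<in> P"
    using assms(1)[of a] spec_up[OF assms(2), of "n a" a] by (simp add: pre_def)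
qed

text \<open>Every element of \<open>P\<close> has the form \<open>n c\<close>, so \<open>P\<close>
  is determined by the elements \<open>c\<close> of its inverse image.\<close>

lemma spec_order_reflecting:
  assumes "n ` carrier L = carrier L" "P \<in> spec L" "pre L n P \<subseteq> pre L n Q"
  shows "P \<subseteq> Q"
proof
  fix b assume b: "b \<in> P"
  then have "b \<in> n ` carrier L" using assms(1) spec_carrier[OF assms(2)] by simp
  then obtain c where "c \<in> carrier L" "b = n c" by (rule imageE)
  then show "b \<in> Q" using b assms(3) by (auto simp: pre_def)
qed

end

section \<open>Algebras of up-sets\<close>

definition upsets :: "'z set \<Rightarrow> ('z \<Rightarrow> 'z \<Rightarrow> bool) \<Rightarrow> 'z set set" where
  "upsets Z R = {U. U \<subseteq> Z \<and> (\<forall>u\<in>U. \<forall>w\<in>Z. R u w \<longrightarrow> w \<in> U)}"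

definition up_nabla :: "'z set \<Rightarrow> ('z \<Rightarrow> 'z) \<Rightarrow> 'z set \<Rightarrow> 'z set" where
  "up_nabla Z p U = {z \<in> Z. p z \<in> U}"

text \<open>The Kripke clause of \<open>spec_imp\<close>, with the points of \<open>Z\<close> as
  prime filters and \<open>p\<close> as inverse image under the operator. If \<open>p\<close> is the
  identity on \<open>Z\<close>, it is the Heyting implication of up-sets of a preorder.\<close>

definition up_imp :: "'z set \<Rightarrow> ('z \<Rightarrow> 'z \<Rightarrow> bool) \<Rightarrow> ('z \<Rightarrow> 'z) \<Rightarrow> 'z set \<Rightarrow> 'z set \<Rightarrow> 'z set" where
  "up_imp Z R p U V = {z \<in> Z. \<forall>w\<in>Z. R z (p w) \<and> w \<in> U \<longrightarrow> w \<in> V}"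

lemma upsets_lattice:
  "{} \<in> upsets Z R" "Z \<in> upsets Z R"
  "\<lbrakk>U \<in> upsets Z R; V \<in> upsets Z R\<rbrakk> \<Longrightarrow> U \<union> V \<in> upsets Z R"
  "\<lbrakk>U \<in> upsets Z R; V \<in> upsets Z R\<rbrakk> \<Longrightarrow> U \<inter> V \<in> upsets Z R"
  by (auto simp: upsets_def)

locale frame =
  fixes Z :: "'z set" and R :: "'z \<Rightarrow> 'z \<Rightarrow> bool" and p :: "'z \<Rightarrow> 'z"
  assumes R_refl: "z \<in> Z \<Longrightarrow> R z z"
    and R_trans: "\<lbrakk>x \<in> Z; y \<in> Z; z \<in> Z; R x y; R y z\<rbrakk> \<Longrightarrow> R x z"
    and p_closed: "z \<in> Z \<Longrightarrow> p z \<in> Z"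
    and p_mono: "\<lbrakk>x \<in> Z; y \<in> Z; R x y\<rbrakk> \<Longrightarrow> R (p x) (p y)"
begin

lemma up_nabla_closed: "U \<in> upsets Z R \<Longrightarrow> up_nabla Z p U \<in> upsets Z R"
  using p_mono p_closed unfolding upsets_def up_nabla_def by blast

lemma up_imp_closed: "up_imp Z R p U V \<in> upsets Z R"
  using R_trans p_closed unfolding upsets_def up_imp_def by blast

text \<open>From left to right, \<open>R z (p w)\<close> carries \<open>z\<close> in
  \<open>W\<close> to \<open>p w\<close> in \<open>W\<close>, because \<open>W\<close> is an up-set.
  From right to left, the implication is tested at the point \<open>p w\<close>, with
  reflexivity.\<close>

lemma up_adjoint:
  assumes "W \<in> upsets Z R"
  shows "up_nabla Z p W \<inter> U \<subseteq> V \<longleftrightarrow> W \<subseteq> up_imp Z R p U V"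
proof
  assume "up_nabla Z p W \<inter> U \<subseteq> V"
  then show "W \<subseteq> up_imp Z R p U V"
    using assms p_closed unfolding upsets_def up_nabla_def up_imp_def by blast
next
  assume "W \<subseteq> up_imp Z R p U V"
  then show "up_nabla Z p W \<inter> U \<subseteq> V"
    using p_closed R_refl unfolding up_nabla_def up_imp_def by blast
qed

lemma up_nabla_top: "up_nabla Z p Z = Z"
  using p_closed by (auto simp: up_nabla_def)

lemma up_nabla_Int: "up_nabla Z p (U \<inter> V) = up_nabla Z p U \<inter> up_nabla Z p V"
  by (auto simp: up_nabla_def)

lemma up_nabla_increasing:
  "\<lbrakk>\<And>z. z \<in> Z \<Longrightarrow> R z (p z); U \<in> upsets Z R\<rbrakk> \<Longrightarrow> U \<subseteq> up_nabla Z p U"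
  using p_closed unfolding upsets_def up_nabla_def by blast

lemma up_nabla_decreasing:
  "\<lbrakk>\<And>z. z \<in> Z \<Longrightarrow> R (p z) z; U \<in> upsets Z R\<rbrakk> \<Longrightarrow> up_nabla Z p U \<subseteq> U"
  using p_closed unfolding upsets_def up_nabla_def by blast

text \<open>An explicit term for a preimage of \<open>U\<close>, so surjectivity is inherited by
  every subalgebra. Order reflection turns \<open>R (p z) (p w)\<close> into \<open>R z w\<close>,
  and \<open>U\<close> is an up-set; the converse takes \<open>w = z\<close>.\<close>

lemma up_nabla_imp_top:
  assumes "\<And>x y. \<lbrakk>x \<in> Z; y \<in> Z; R (p x) (p y)\<rbrakk> \<Longrightarrow> R x y" "U \<in> upsets Z R"
  shows "up_nabla Z p (up_imp Z R p Z U) = U"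
proof (intro Set.set_eqI iffI)
  fix z assume "z \<in> up_nabla Z p (up_imp Z R p Z U)"
  then show "z \<in> U" using R_refl[OF p_closed] by (auto simp: up_nabla_def up_imp_def)
next
  fix z assume z: "z \<in> U"
  then have zZ: "z \<in> Z" using assms(2) by (auto simp: upsets_def)
  have "w \<in> U" if "w \<in> Z" "R (p z) (p w)" for w
    using assms(1)[OF zZ that] assms(2) z that(1) by (auto simp: upsets_def)
  then show "z \<in> up_nabla Z p (up_imp Z R p Z U)"
    using zZ p_closed by (auto simp: up_nabla_def up_imp_def)
qed

end

text \<open>A family \<open>S\<close> of subsets of \<open>Z\<close> copied along the injection
  \<open>h\<close> into another type. This brings an algebra of sets of points into the prescribed
  universe.\<close>

locale set_algebra =
  fixes B :: "('b, 'm) nabla_algebra_scheme" (structure)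
    and S :: "'z set set" and Z :: "'z set" and h :: "'z set \<Rightarrow> 'b"
    and N :: "'z set \<Rightarrow> 'z set" and J :: "'z set \<Rightarrow> 'z set \<Rightarrow> 'z set"
  assumes carrier: "carrier B = h ` S" and inj: "inj_on h S" and eq: "eq B = (=)"
    and le: "\<lbrakk>U \<in> S; V \<in> S\<rbrakk> \<Longrightarrow> h U \<sqsubseteq> h V \<longleftrightarrow> U \<subseteq> V"
    and nabla: "U \<in> S \<Longrightarrow> nabla B (h U) = h (N U)"
    and imp: "\<lbrakk>U \<in> S; V \<in> S\<rbrakk> \<Longrightarrow> imp B (h U) (h V) = h (J U V)"
    and empty: "{} \<in> S" and top: "Z \<in> S" and le_top: "U \<in> S \<Longrightarrow> U \<subseteq> Z"
    and Un: "\<lbrakk>U \<in> S; V \<in> S\<rbrakk> \<Longrightarrow> U \<union> V \<in> S"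
    and Int: "\<lbrakk>U \<in> S; V \<in> S\<rbrakk> \<Longrightarrow> U \<inter> V \<in> S"
    and N_closed: "U \<in> S \<Longrightarrow> N U \<in> S"
    and J_closed: "\<lbrakk>U \<in> S; V \<in> S\<rbrakk> \<Longrightarrow> J U V \<in> S"
    and adjoint: "\<lbrakk>U \<in> S; V \<in> S; W \<in> S\<rbrakk> \<Longrightarrow> N W \<inter> U \<subseteq> V \<longleftrightarrow> W \<subseteq> J U V"
begin

lemma h_eq: "\<lbrakk>U \<in> S; V \<in> S\<rbrakk> \<Longrightarrow> h U = h V \<longleftrightarrow> U = V"
  using inj by (auto simp: inj_on_def)

lemma lub: "\<lbrakk>U \<in> S; V \<in> S\<rbrakk> \<Longrightarrow> is_lub B (h (U \<union> V)) {h U, h V}"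
  by (auto simp: least_def Upper_def carrier le Un)

lemma glb: "\<lbrakk>U \<in> S; V \<in> S\<rbrakk> \<Longrightarrow> is_glb B (h (U \<inter> V)) {h U, h V}"
  by (auto simp: greatest_def Lower_def carrier le Int)

lemma bounded_lattice: "bounded_lattice B"
proof unfold_locales
  show "\<exists>s. is_lub B s {x, y}" if "x \<in> carrier B" "y \<in> carrier B" for x y
    using that lub unfolding carrier by blast
  show "\<exists>s. is_glb B s {x, y}" if "x \<in> carrier B" "y \<in> carrier B" for x y
    using that glb unfolding carrier by blast
  show "\<exists>x. least B x (carrier B)"
    using empty by (intro exI[of _ "h {}"]) (auto simp: least_def carrier le)
  show "\<exists>x. greatest B x (carrier B)"
    using top le_top by (intro exI[of _ "h Z"]) (auto simp: greatest_def carrier le)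
qed (auto simp: eq carrier le h_eq)

sublocale bounded_lattice B
  by (rule bounded_lattice)

lemma h_closed: "U \<in> S \<Longrightarrow> h U \<in> carrier B"
  by (simp add: carrier)

text \<open>The join is a choice among the least upper bounds, so its value rests on their
  uniqueness up to \<open>eq B\<close>, which is equality here.\<close>

lemma join:
  assumes "U \<in> S" "V \<in> S"
  shows "h U \<squnion> h V = h (U \<union> V)"
proof -
  have "x = h (U \<union> V)" if "is_lub B x {h U, h V}" for x
    using weak_least_unique[OF that lub[OF assms]] by (simp add: eq_is_equal)
  then show ?thesis
    unfolding join_def sup_def by (intro some_equality lub assms)
qed

lemma meet:
  assumes "U \<in> S" "V \<in> S"
  shows "h U \<sqinter> h V = h (U \<inter> V)"
proof -
  have "x = h (U \<inter> V)" if "is_glb B x {h U, h V}" for x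
    using weak_greatest_unique[OF that glb[OF assms]] by (simp add: eq_is_equal)
  then show ?thesis
    unfolding meet_def inf_def by (intro some_equality glb assms)
qed

lemma bottom_h: "\<bottom> = h {}"
  by (rule bottom_eq[symmetric]) (auto simp: carrier le empty)

lemma top_h: "\<top> = h Z"
  using le_top by (intro top_eq[symmetric]) (auto simp: carrier le top)

lemma nabla_algebra: "nabla_algebra B"
proof (intro nabla_algebra.intro bounded_lattice nabla_algebra_axioms.intro)
  show "nabla B a \<in> carrier B" if "a \<in> carrier B" for a
    using that by (auto simp: carrier nabla N_closed)
  show "imp B a b \<in> carrier B" if "a \<in> carrier B" "b \<in> carrier B" for a b
    using that by (auto simp: carrier imp J_closed)
  show "nabla B c \<sqinter> a \<sqsubseteq> b \<longleftrightarrow> c \<sqsubseteq> imp B a b"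
    if "a \<in> carrier B" "b \<in> carrier B" "c \<in> carrier B" for a b c
    using that by (auto simp: carrier nabla imp N_closed J_closed meet le Int adjoint)
qed

lemma satisfies_D: "satisfies B Cond_D"
  by (auto simp: carrier join meet Un Int intro!: arg_cong[of _ _ h])

lemma satisfies_N:
  assumes "N Z = Z" "\<And>U V. \<lbrakk>U \<in> S; V \<in> S\<rbrakk> \<Longrightarrow> N (U \<inter> V) = N U \<inter> N V"
  shows "satisfies B Cond_N"
  using assms by (auto simp: carrier top_h nabla top meet Int N_closed)

lemma satisfies_R:
  assumes "\<And>U. U \<in> S \<Longrightarrow> U \<subseteq> N U"
  shows "satisfies B Cond_R"
  using assms by (auto simp: carrier nabla le N_closed)

lemma satisfies_L:
  assumes "\<And>U. U \<in> S \<Longrightarrow> N U \<subseteq> U"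
  shows "satisfies B Cond_L"
  using assms by (auto simp: carrier nabla le N_closed)

lemma satisfies_Fa:
  assumes "\<And>U. U \<in> S \<Longrightarrow> N (J Z U) = U"
  shows "satisfies B Cond_Fa"
proof -
  have "h U \<in> nabla B ` h ` S" if "U \<in> S" for U
    using assms[OF that] nabla[OF J_closed[OF top that]] J_closed[OF top that] by (metis imageI)
  then show ?thesis by (auto simp: carrier nabla N_closed)
qed

end

section \<open>Stone representation over a frame\<close>

definition hat :: "'z set \<Rightarrow> ('z \<Rightarrow> 'a set) \<Rightarrow> 'a \<Rightarrow> 'z set" where
  "hat Z q a = {z \<in> Z. a \<in> q z}"

text \<open>The map \<open>q\<close> is a surjective bounded morphism from the frame onto the prime
  spectrum of \<open>L\<close>. Several points may carry the same prime filter, as happens for the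
  projections of a fibre product; \<open>hat\<close> is the dual embedding.\<close>

locale representation = adjoint_lattice L n j + frame Z R p
  for L (structure) and n j and Z :: "'z set" and R p +
  fixes q :: "'z \<Rightarrow> 'a set"
  assumes q_spec: "z \<in> Z \<Longrightarrow> q z \<in> spec L"
    and q_mono: "\<lbrakk>z \<in> Z; w \<in> Z; R z w\<rbrakk> \<Longrightarrow> q z \<subseteq> q w"
    and q_p: "z \<in> Z \<Longrightarrow> q (p z) = pre L n (q z)"
    and q_back: "\<lbrakk>z \<in> Z; Q \<in> spec L; q z \<subseteq> pre L n Q\<rbrakk> \<Longrightarrow> \<exists>w\<in>Z. R z (p w) \<and> q w = Q"
    and q_surj: "Q \<in> spec L \<Longrightarrow> \<exists>z\<in>Z. q z = Q"
begin

lemma hat_upset: "hat Z q a \<in> upsets Z R"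
  using q_mono by (auto simp: hat_def upsets_def)

lemma hat_bottom: "hat Z q \<bottom> = {}"
  using spec_bottom[OF q_spec] by (auto simp: hat_def)

lemma hat_top: "hat Z q \<top> = Z"
  using spec_top[OF q_spec] by (auto simp: hat_def)

lemma hat_meet: "\<lbrakk>a \<in> carrier L; b \<in> carrier L\<rbrakk> \<Longrightarrow> hat Z q (a \<sqinter> b) = hat Z q a \<inter> hat Z q b"
  using spec_meet[OF q_spec] by (auto simp: hat_def)

lemma hat_join: "\<lbrakk>a \<in> carrier L; b \<in> carrier L\<rbrakk> \<Longrightarrow> hat Z q (a \<squnion> b) = hat Z q a \<union> hat Z q b"
  using spec_join[OF q_spec] by (auto simp: hat_def)

lemma hat_n: "a \<in> carrier L \<Longrightarrow> hat Z q (n a) = up_nabla Z p (hat Z q a)"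
  using p_closed by (auto simp: hat_def up_nabla_def q_p pre_def)

text \<open>By \<open>q_mono\<close>, \<open>q_p\<close> and \<open>q_back\<close>, the prime
  filters over which \<open>spec_imp\<close> quantifies at \<open>q z\<close> are exactly the
  \<open>q w\<close> with \<open>R z (p w)\<close>.\<close>

lemma hat_j:
  assumes ab: "a \<in> carrier L" "b \<in> carrier L"
  shows "hat Z q (j a b) = up_imp Z R p (hat Z q a) (hat Z q b)"
proof (intro Set.set_eqI iffI)
  fix z assume "z \<in> hat Z q (j a b)"
  then have z: "z \<in> Z" "j a b \<in> q z" by (auto simp: hat_def)
  have "b \<in> q w" if w: "w \<in> Z" "R z (p w)" "a \<in> q w" for w
    using z w q_mono[OF z(1) p_closed[OF w(1)] w(2)] q_p[OF w(1)] q_spec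
      spec_imp[OF q_spec[OF z(1)] ab] by simp
  then show "z \<in> up_imp Z R p (hat Z q a) (hat Z q b)"
    using z by (auto simp: hat_def up_imp_def)
next
  fix z assume z: "z \<in> up_imp Z R p (hat Z q a) (hat Z q b)"
  then have zZ: "z \<in> Z" by (simp add: up_imp_def)
  have "b \<in> Q" if Q: "Q \<in> spec L" "q z \<subseteq> pre L n Q" "a \<in> Q" for Q
  proof -
    obtain w where "w \<in> Z" "R z (p w)" "q w = Q" using q_back[OF zZ Q(1,2)] by blast
    then show ?thesis using z Q(3) by (auto simp: up_imp_def hat_def)
  qed
  then show "z \<in> hat Z q (j a b)"
    using zZ spec_imp[OF q_spec[OF zZ] ab] by (simp add: hat_def)
qed

text \<open>Otherwise a prime filter contains \<open>a\<close> and not \<open>b\<close>, and by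
  \<open>q_surj\<close> it sits at some point of \<open>Z\<close>.\<close>

lemma hat_le:
  assumes ab: "a \<in> carrier L" "b \<in> carrier L" and sub: "hat Z q a \<subseteq> hat Z q b"
  shows "a \<sqsubseteq> b"
proof (rule ccontr)
  assume no: "\<not> a \<sqsubseteq> b"
  obtain Q where Q: "Q \<in> spec L" "{a} \<subseteq> Q" "Q \<inter> {b} = {}"
    by (rule prime_filter_exists[of "{a}" "{b}"]) (use ab no in \<open>simp_all add: meet_absorb join_absorb\<close>)
  obtain z where "z \<in> Z" "q z = Q" using q_surj[OF Q(1)] by blast
  then show False using Q sub by (auto simp: hat_def)
qed

lemma hat_inj: "inj_on (hat Z q) (carrier L)"
  by (rule inj_onI) (rule le_antisym; simp add: hat_le)

end
section \<open>The fibre product of prime spectra\<close>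

definition fibre_product ::
  "('c, 'k) gorder_scheme \<Rightarrow> ('a, 'm) gorder_scheme \<Rightarrow> ('b, 'n) gorder_scheme
    \<Rightarrow> ('c \<Rightarrow> 'a) \<Rightarrow> ('c \<Rightarrow> 'b) \<Rightarrow> ('a set \<times> 'b set) set" where
  "fibre_product L0 L1 L2 f1 f2 =
    {(x, y). x \<in> spec L1 \<and> y \<in> spec L2 \<and> pre L0 f1 x = pre L0 f2 y}"

definition pair_le :: "'a set \<times> 'b set \<Rightarrow> 'a set \<times> 'b set \<Rightarrow> bool" where
  "pair_le z w \<longleftrightarrow> fst z \<subseteq> fst w \<and> snd z \<subseteq> snd w"

text \<open>Keeping \<open>n\<close> and \<open>j\<close> arbitrary lets the argument on spectra
  serve \<open>nabla\<close> with \<open>imp\<close> as well as the identity with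
  \<open>himp\<close>.\<close>

locale adjoint_embedding =
  L0: adjoint_lattice L0 n0 j0 + L: adjoint_lattice L n j
  for L0 :: "('c, 'k) gorder_scheme" and n0 j0 and L :: "('a, 'm) gorder_scheme" and n j +
  fixes f :: "'c \<Rightarrow> 'a"
  assumes f_hom: "lattice_hom L0 L f" and f_inj: "inj_on f (carrier L0)"
    and f_n: "a \<in> carrier L0 \<Longrightarrow> f (n0 a) = n (f a)"
    and f_j: "\<lbrakk>a \<in> carrier L0; b \<in> carrier L0\<rbrakk> \<Longrightarrow> f (j0 a b) = j (f a) (f b)"
begin

lemma f_closed: "a \<in> carrier L0 \<Longrightarrow> f a \<in> carrier L"
  using f_hom by (simp add: lattice_hom_def)

text \<open>The dual of \<open>f_n\<close>: restriction commutes with the maps on the spectra. Hence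
  the fibre product is closed under the componentwise map.\<close>

lemma pre_n: "pre L0 f (pre L n P) = pre L0 n0 (pre L0 f P)"
  using f_closed f_n L0.n_closed by (auto simp: pre_def)

lemma f_spec: "P \<in> spec L \<Longrightarrow> pre L0 f P \<in> spec L0"
  by (rule pre_spec[OF L0.bounded_lattice_axioms f_hom])

lemma f_surj: "z \<in> spec L0 \<Longrightarrow> \<exists>w\<in>spec L. pre L0 f w = z"
  using spec_surj[OF L0.bounded_lattice_axioms L.distributive_lattice_axioms f_hom f_inj] by metis

lemma f_lift:
  assumes "y \<in> spec L" "z \<in> spec L0" "pre L0 f y \<subseteq> pre L0 n0 z"
  shows "\<exists>w\<in>spec L. pre L0 f w = z \<and> y \<subseteq> pre L n w"
  using spec_lift[OF L0.adjoint_lattice_axioms L.adjoint_lattice_axioms f_hom f_j assms] by metis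

end

locale adjoint_span =
  E1: adjoint_embedding L0 n0 j0 L1 n1 j1 f1 + E2: adjoint_embedding L0 n0 j0 L2 n2 j2 f2
  for L0 :: "('c, 'k) gorder_scheme" and n0 j0
    and L1 :: "('a, 'm) gorder_scheme" and n1 j1 and L2 :: "('b, 'n) gorder_scheme" and n2 j2
    and f1 f2
begin

text \<open>\<open>Z\<close> depends only on the lattices and the two embeddings. The spans for
  \<open>imp\<close> and for \<open>himp\<close> therefore share points and order and differ only in
  \<open>p\<close>.\<close>

abbreviation "Z \<equiv> fibre_product L0 L1 L2 f1 f2"
abbreviation "p \<equiv> map_prod (pre L1 n1) (pre L2 n2)"

sublocale frame Z pair_le p
proof
  show "p z \<in> Z" if "z \<in> Z" for z
    using that E1.L.spec_n E2.L.spec_n E1.pre_n E2.pre_n by (auto simp: fibre_product_def)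
  show "pair_le (p z) (p w)" if "pair_le z w" for z w
    using that by (auto simp: pair_le_def pre_def)
qed (auto simp: pair_le_def)

text \<open>For the back condition the first component \<open>Q\<close> is prescribed;
  \<open>f_lift\<close> finds a second component above \<open>snd z\<close> with the same
  restriction to \<open>L0\<close>, so the pair stays in \<open>Z\<close>. Surjectivity completes
  \<open>Q\<close> in the same way by \<open>f_surj\<close>.\<close>

lemma representation_fst: "representation L1 n1 j1 Z pair_le p fst"
proof unfold_locales
  fix z Q assume z: "z \<in> Z" and Q: "Q \<in> spec L1" "fst z \<subseteq> pre L1 n1 Q"
  have "pre L0 f2 (snd z) = pre L0 f1 (fst z)" using z by (auto simp: fibre_product_def)
  also have "\<dots> \<subseteq> pre L0 f1 (pre L1 n1 Q)" using Q(2) by (auto simp: pre_def)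
  finally have "pre L0 f2 (snd z) \<subseteq> pre L0 n0 (pre L0 f1 Q)" by (simp add: E1.pre_n)
  moreover have "snd z \<in> spec L2" using z by (auto simp: fibre_product_def)
  ultimately obtain w where "w \<in> spec L2" "pre L0 f2 w = pre L0 f1 Q" "snd z \<subseteq> pre L2 n2 w"
    using E2.f_lift E1.f_spec[OF Q(1)] by metis
  then have "(Q, w) \<in> Z \<and> pair_le z (p (Q, w)) \<and> fst (Q, w) = Q"
    using Q by (auto simp: fibre_product_def pair_le_def)
  then show "\<exists>w\<in>Z. pair_le z (p w) \<and> fst w = Q" by metis
next
  fix Q assume Q: "Q \<in> spec L1"
  then obtain w where "w \<in> spec L2" "pre L0 f2 w = pre L0 f1 Q"
    using E2.f_surj[OF E1.f_spec[OF Q]] by metis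
  then have "(Q, w) \<in> Z \<and> fst (Q, w) = Q" using Q by (auto simp: fibre_product_def)
  then show "\<exists>z\<in>Z. fst z = Q" by metis
qed (auto simp: fibre_product_def pair_le_def)

text \<open>The mirror image of \<open>representation_fst\<close>, with the two sides of the span
  exchanged.\<close>

lemma representation_snd: "representation L2 n2 j2 Z pair_le p snd"
proof unfold_locales
  fix z Q assume z: "z \<in> Z" and Q: "Q \<in> spec L2" "snd z \<subseteq> pre L2 n2 Q"
  have "pre L0 f1 (fst z) = pre L0 f2 (snd z)" using z by (auto simp: fibre_product_def)
  also have "\<dots> \<subseteq> pre L0 f2 (pre L2 n2 Q)" using Q(2) by (auto simp: pre_def)
  finally have "pre L0 f1 (fst z) \<subseteq> pre L0 n0 (pre L0 f2 Q)" by (simp add: E2.pre_n)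
  moreover have "fst z \<in> spec L1" using z by (auto simp: fibre_product_def)
  ultimately obtain w where "w \<in> spec L1" "pre L0 f1 w = pre L0 f2 Q" "fst z \<subseteq> pre L1 n1 w"
    using E1.f_lift E2.f_spec[OF Q(1)] by metis
  then have "(w, Q) \<in> Z \<and> pair_le z (p (w, Q)) \<and> snd (w, Q) = Q"
    using Q by (auto simp: fibre_product_def pair_le_def)
  then show "\<exists>w\<in>Z. pair_le z (p w) \<and> snd w = Q" by metis
next
  fix Q assume Q: "Q \<in> spec L2"
  then obtain w where "w \<in> spec L1" "pre L0 f1 w = pre L0 f2 Q"
    using E1.f_surj[OF E2.f_spec[OF Q]] by metis
  then have "(w, Q) \<in> Z \<and> snd (w, Q) = Q" using Q by (auto simp: fibre_product_def)
  then show "\<exists>z\<in>Z. snd z = Q" by metis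
qed (auto simp: fibre_product_def pair_le_def)

text \<open>The components of a point of \<open>Z\<close> agree on \<open>L0\<close>, and this makes
  the amalgamation square commute.\<close>

lemma hat_span: "a \<in> carrier L0 \<Longrightarrow> hat Z fst (f1 a) = hat Z snd (f2 a)"
  unfolding hat_def fibre_product_def pre_def by auto

end

section \<open>Amalgams\<close>

lemma card_of_Un_ordLeq_infinite:
  includes cardinal_syntax
  assumes "infinite C" "|A| \<le>o |C|" "|B| \<le>o |C|"
  shows "|A \<union> B| \<le>o |C|"
  by (rule card_of_Un_ordLeq_infinite_Field[OF _ _ _ card_of_Card_order])
    (use assms in \<open>simp_all add: Field_card_of\<close>)

text \<open>The closure is the union of the stages \<open>E k\<close>, each of which adds all values
  of finitely many binary operations on the previous one. For an infinite type, products, finite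
  unions and countable unions do not raise the cardinality above that of the type, so the closure
  injects into it.\<close>

lemma closure_exists:
  includes cardinal_syntax
  fixes A T :: "'s set" and F :: "('s \<Rightarrow> 's \<Rightarrow> 's) set"
  assumes inf: "infinite (UNIV :: 'a set)" and fin: "finite F" and A: "|A| \<le>o |UNIV :: 'a set|"
    and "A \<subseteq> T" and T: "\<And>f x y. \<lbrakk>f \<in> F; x \<in> T; y \<in> T\<rbrakk> \<Longrightarrow> f x y \<in> T"
  obtains S and h :: "'s \<Rightarrow> 'a" where "A \<subseteq> S" "S \<subseteq> T" "inj_on h S"
    "\<And>f x y. \<lbrakk>f \<in> F; x \<in> S; y \<in> S\<rbrakk> \<Longrightarrow> f x y \<in> S"
proof -
  define E where "E = rec_nat A (\<lambda>_ X. X \<union> (\<Union>f\<in>F. case_prod f ` (X \<times> X)))"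
  have E0: "E 0 = A" and ES: "\<And>k. E (Suc k) = E k \<union> (\<Union>f\<in>F. case_prod f ` (E k \<times> E k))"
    by (simp_all add: E_def)
  have mono: "k \<le> l \<Longrightarrow> E k \<subseteq> E l" for k l
    by (rule lift_Suc_mono_le[of E]) (auto simp: ES)
  have sub: "E k \<subseteq> T" for k
    by (induction k) (use \<open>A \<subseteq> T\<close> T in \<open>auto simp: E0 ES subset_iff\<close>)
  have size: "|E k| \<le>o |UNIV :: 'a set|" for k
  proof (induction k)
    case (Suc k)
    have "|case_prod f ` (E k \<times> E k)| \<le>o |UNIV :: 'a set|" for f
      by (rule ordLeq_transitive[OF card_of_image card_of_Sigma_ordLeq_infinite])
        (use inf Suc in auto)
    moreover have "|F| \<le>o |UNIV :: 'a set|"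
      using finite_ordLess_infinite[OF card_of_Well_order[of F] card_of_Well_order[of "UNIV :: 'a set"]]
        inf fin by (simp add: ordLess_imp_ordLeq Field_card_of)
    ultimately have "|\<Union>f\<in>F. case_prod f ` (E k \<times> E k)| \<le>o |UNIV :: 'a set|"
      by (intro card_of_UNION_ordLeq_infinite) (use inf in auto)
    with Suc show ?case
      unfolding ES by (intro card_of_Un_ordLeq_infinite) (use inf in auto)
  qed (simp add: E0 A)
  have "|\<Union>k. E k| \<le>o |UNIV :: 'a set|"
    by (rule card_of_UNION_ordLeq_infinite)
      (use inf size infinite_iff_card_of_nat in auto)
  then obtain h :: "'s \<Rightarrow> 'a" where "inj_on h (\<Union>k. E k)"
    unfolding card_of_ordLeq[symmetric] by blast
  moreover have "f x y \<in> (\<Union>k. E k)" if f: "f \<in> F" and xy: "x \<in> (\<Union>k. E k)" "y \<in> (\<Union>k. E k)" for f x y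
  proof -
    obtain k l where "x \<in> E k" "y \<in> E l" using xy by blast
    then have "x \<in> E (max k l)" "y \<in> E (max k l)" using mono[of k "max k l"] mono[of l "max k l"] by auto
    then have "f x y \<in> E (Suc (max k l))" using f unfolding ES by force
    then show ?thesis by blast
  qed
  moreover have "A \<subseteq> (\<Union>k. E k)" "(\<Union>k. E k) \<subseteq> T" using E0 sub by blast+
  ultimately show ?thesis by (intro that[of "\<Union>k. E k" h])
qed

text \<open>\<open>S\<close> is the subalgebra generated by both Stone images, which is small enough
  to be injected into \<open>'d\<close>. The parameter \<open>K\<close> is a place for one more
  operation, filled by the Heyting implication when there is one.\<close>

lemma (in adjoint_span) amalgam_carrier:
  fixes K :: "('a set \<times> 'b set) set \<Rightarrow> ('a set \<times> 'b set) set \<Rightarrow> ('a set \<times> 'b set) set"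
    and e1 :: "'a \<Rightarrow> 'd" and e2 :: "'b \<Rightarrow> 'd"
  assumes inf: "infinite (UNIV :: 'd set)" and e: "inj e1" "inj e2"
    and K: "\<And>U V. K U V \<in> upsets Z pair_le"
  obtains S and h :: "('a set \<times> 'b set) set \<Rightarrow> 'd" where "S \<subseteq> upsets Z pair_le" "inj_on h S"
    "hat Z fst ` carrier L1 \<subseteq> S" "hat Z snd ` carrier L2 \<subseteq> S"
    "\<And>U V. \<lbrakk>U \<in> S; V \<in> S\<rbrakk> \<Longrightarrow> U \<union> V \<in> S" "\<And>U V. \<lbrakk>U \<in> S; V \<in> S\<rbrakk> \<Longrightarrow> U \<inter> V \<in> S"
    "\<And>U. U \<in> S \<Longrightarrow> up_nabla Z p U \<in> S"
    "\<And>U V. \<lbrakk>U \<in> S; V \<in> S\<rbrakk> \<Longrightarrow> up_imp Z pair_le p U V \<in> S"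
    "\<And>U V. \<lbrakk>U \<in> S; V \<in> S\<rbrakk> \<Longrightarrow> K U V \<in> S"
proof -
  include cardinal_syntax
  interpret R1: representation L1 n1 j1 Z pair_le p fst by (rule representation_fst)
  interpret R2: representation L2 n2 j2 Z pair_le p snd by (rule representation_snd)
  let ?A = "hat Z fst ` carrier L1 \<union> hat Z snd ` carrier L2"
  \<comment> \<open>The unary operation is listed as a binary one that ignores its second
    argument.\<close>
  let ?F = "{(\<union>), (\<inter>), (\<lambda>U V. up_nabla Z p U), up_imp Z pair_le p, K}"
  have "|carrier L1| \<le>o |UNIV :: 'd set|" "|carrier L2| \<le>o |UNIV :: 'd set|"
    using e unfolding card_of_ordLeq[symmetric] by (meson inj_on_subset subset_UNIV)+
  then have "|?A| \<le>o |UNIV :: 'd set|"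
    by (intro card_of_Un_ordLeq_infinite ordLeq_transitive[OF card_of_image] inf)
  moreover have "?A \<subseteq> upsets Z pair_le" using R1.hat_upset R2.hat_upset by auto
  moreover have "f U V \<in> upsets Z pair_le"
    if "f \<in> ?F" "U \<in> upsets Z pair_le" "V \<in> upsets Z pair_le" for f U V
    using that upsets_lattice(3,4) up_nabla_closed up_imp_closed K by auto
  ultimately obtain S and h :: "('a set \<times> 'b set) set \<Rightarrow> 'd" where S: "?A \<subseteq> S"
      "S \<subseteq> upsets Z pair_le" "inj_on h S"
    and cl: "\<And>f U V. \<lbrakk>f \<in> ?F; U \<in> S; V \<in> S\<rbrakk> \<Longrightarrow> f U V \<in> S"
    by (rule_tac closure_exists[OF inf, of ?F ?A "upsets Z pair_le"]) auto
  show ?thesis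
  proof (rule that[of S h])
    show "up_nabla Z p U \<in> S" if "U \<in> S" for U
      using cl[of "\<lambda>U V. up_nabla Z p U" U U] that by simp
  qed (use S cl[of "(\<union>)"] cl[of "(\<inter>)"] cl[of "up_imp Z pair_le p"] cl[of K] in auto)
qed

lemma set_algebra_embedding:
  fixes A :: "('a, 'n) nabla_algebra_scheme" and B :: "('b, 'm) nabla_algebra_scheme"
  assumes A: "representation A (nabla A) (imp A) Z R p q"
    and B: "set_algebra B S Z h (up_nabla Z p) (up_imp Z R p)" and sub: "hat Z q ` carrier A \<subseteq> S"
  shows "embedding nabla_hom A B (h \<circ> hat Z q)"
proof -
  interpret A: representation A "nabla A" "imp A" Z R p q by fact
  interpret B: set_algebra B S Z h "up_nabla Z p" "up_imp Z R p" by fact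
  have S: "hat Z q a \<in> S" if "a \<in> carrier A" for a using sub that by auto
  have "nabla_hom A B (h \<circ> hat Z q)"
    unfolding nabla_hom_def
    by (simp add: S B.h_closed A.hat_bottom A.hat_top A.hat_meet A.hat_join A.hat_n A.hat_j
        B.bottom_h B.top_h B.meet B.join B.nabla B.imp)
  moreover have "inj_on (h \<circ> hat Z q) (carrier A)"
    by (rule comp_inj_on[OF A.hat_inj inj_on_subset[OF B.inj sub]])
  ultimately show ?thesis by (simp add: embedding_def)
qed

text \<open>(D) and (N) hold for the set operations themselves. For (R), (L) and (Fa) the property
  of the two spectra passes to \<open>Z\<close> componentwise, and from there to the up-sets in
  \<open>S\<close>.\<close>

lemma set_algebra_satisfies:
  fixes L0 :: "('c, 'k) nabla_algebra_scheme" and L1 :: "('a, 'm) nabla_algebra_scheme"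
    and L2 :: "('b, 'n) nabla_algebra_scheme" and B :: "('d, 'l) nabla_algebra_scheme"
    and f1 :: "'c \<Rightarrow> 'a" and f2 :: "'c \<Rightarrow> 'b"
  defines "Z \<equiv> fibre_product L0 L1 L2 f1 f2" and "p \<equiv> map_prod (pre L1 (nabla L1)) (pre L2 (nabla L2))"
  assumes "adjoint_span L0 (nabla L0) (imp L0) L1 (nabla L1) (imp L1) L2 (nabla L2) (imp L2) f1 f2"
    and "set_algebra B S Z h (up_nabla Z p) (up_imp Z pair_le p)" and S: "S \<subseteq> upsets Z pair_le"
    and c: "satisfies L1 c" "satisfies L2 c"
  shows "satisfies B c"
proof -
  interpret adjoint_span L0 "nabla L0" "imp L0" L1 "nabla L1" "imp L1" L2 "nabla L2" "imp L2" f1 f2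
    by fact
  interpret B: set_algebra B S Z h "up_nabla Z p" "up_imp Z pair_le p" by fact
  note folds = Z_def[symmetric] p_def[symmetric]
  have Z: "fst z \<in> spec L1" "snd z \<in> spec L2" if "z \<in> Z" for z
    using that by (auto simp: Z_def fibre_product_def)
  have US: "U \<in> upsets Z pair_le" if "U \<in> S" for U using S that by auto
  show ?thesis
  proof (cases c)
    case Cond_D
    show ?thesis unfolding Cond_D by (rule B.satisfies_D)
  next
    case Cond_N
    show ?thesis
      unfolding Cond_N by (rule B.satisfies_N) (rule up_nabla_top[unfolded folds] up_nabla_Int[unfolded folds])+
  next
    case Cond_R
    have "pair_le z (p z)" if "z \<in> Z" for z
      using c Z[OF that] E1.L.spec_increasing E2.L.spec_increasing
      unfolding Cond_R by (simp add: pair_le_def p_def)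
    then show ?thesis
      unfolding Cond_R using US up_nabla_increasing[unfolded folds] by (intro B.satisfies_R) simp
  next
    case Cond_L
    have "pair_le (p z) z" if "z \<in> Z" for z
      using c Z[OF that] E1.L.spec_decreasing E2.L.spec_decreasing
      unfolding Cond_L by (simp add: pair_le_def p_def)
    then show ?thesis
      unfolding Cond_L using US up_nabla_decreasing[unfolded folds] by (intro B.satisfies_L) simp
  next
    case Cond_Fa
    have "pair_le z w" if "z \<in> Z" "w \<in> Z" "pair_le (p z) (p w)" for z w
      using c Z[OF that(1)] that(3) E1.L.spec_order_reflecting E2.L.spec_order_reflecting
      unfolding Cond_Fa by (simp add: pair_le_def p_def)
    then show ?thesis
      unfolding Cond_Fa using US up_nabla_imp_top[unfolded folds] by (intro B.satisfies_Fa) simp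
  qed
qed

section \<open>The two kinds of algebras as adjoint lattices\<close>

lemma nabla_adjoint_lattice:
  assumes "nabla_algebra A" "satisfies A Cond_D" "satisfies A Cond_N"
  shows "adjoint_lattice A (nabla A) (imp A)"
proof -
  interpret nabla_algebra A by fact
  show ?thesis
  proof unfold_locales
    show "nabla A c \<sqinter>\<^bsub>A\<^esub> a \<sqsubseteq>\<^bsub>A\<^esub> b \<longleftrightarrow> c \<sqsubseteq>\<^bsub>A\<^esub> imp A a b"
      if "a \<in> carrier A" "b \<in> carrier A" "c \<in> carrier A" for a b c
      using that by (rule nabla_imp_adjoint)
  qed (use assms(2,3) nabla_closed imp_closed in simp_all)
qed

text \<open>Meeting with \<open>a\<close> is left adjoint to \<open>himp A a\<close> and so
  preserves joins. This supplies (D), which is not among the conditions imposed on the Heyting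
  classes.\<close>

lemma (in heyting_nabla_algebra) satisfies_D: "satisfies A Cond_D"
proof -
  have "a \<sqinter> (b \<squnion> c) = (a \<sqinter> b) \<squnion> (a \<sqinter> c)"
    if abc: "a \<in> carrier A" "b \<in> carrier A" "c \<in> carrier A" for a b c
  proof (rule le_antisym)
    let ?d = "(a \<sqinter> b) \<squnion> (a \<sqinter> c)"
    have "b \<sqinter> a \<sqsubseteq> ?d" "c \<sqinter> a \<sqsubseteq> ?d"
      using abc join_left join_right by (simp_all add: meet_comm)
    then have "b \<squnion> c \<sqsubseteq> himp A a ?d"
      using abc himp_adjoint himp_closed by (simp add: join_le_iff)
    then have "(b \<squnion> c) \<sqinter> a \<sqsubseteq> ?d" using abc himp_adjoint by simp
    then show "a \<sqinter> (b \<squnion> c) \<sqsubseteq> ?d" by (simp add: meet_comm)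
    show "?d \<sqsubseteq> a \<sqinter> (b \<squnion> c)"
      using abc by (simp add: meet_order join_le_iff le_joinI1 le_joinI2)
  qed (use abc in simp_all)
  then show ?thesis by simp
qed

lemma heyting_adjoint_lattice:
  assumes "heyting_nabla_algebra A"
  shows "adjoint_lattice A (\<lambda>a. a) (himp A)"
proof -
  interpret heyting_nabla_algebra A by fact
  show ?thesis
  proof unfold_locales
    show "c \<sqinter>\<^bsub>A\<^esub> a \<sqsubseteq>\<^bsub>A\<^esub> b \<longleftrightarrow> c \<sqsubseteq>\<^bsub>A\<^esub> himp A a b"
      if "a \<in> carrier A" "b \<in> carrier A" "c \<in> carrier A" for a b c
      using that by (rule himp_adjoint)
  qed (use satisfies_D himp_closed in simp_all)
qed

lemma nabla_hom_lattice_hom: "nabla_hom A B f \<Longrightarrow> lattice_hom A B f"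
  unfolding nabla_hom_def lattice_hom_def by simp

lemma nabla_adjoint_embedding:
  assumes "adjoint_lattice A (nabla A) (imp A)" "adjoint_lattice B (nabla B) (imp B)"
    and "embedding nabla_hom A B f"
  shows "adjoint_embedding A (nabla A) (imp A) B (nabla B) (imp B) f"
  using assms nabla_hom_lattice_hom
  by (auto simp: adjoint_embedding_def adjoint_embedding_axioms_def embedding_def nabla_hom_def)

lemma heyting_adjoint_embedding:
  assumes "heyting_nabla_algebra A" "heyting_nabla_algebra B" "embedding heyting_nabla_hom A B f"
  shows "adjoint_embedding A (\<lambda>a. a) (himp A) B (\<lambda>a. a) (himp B) f"
  using assms(3) heyting_adjoint_lattice[OF assms(1)] heyting_adjoint_lattice[OF assms(2)]
    nabla_hom_lattice_hom
  by (auto simp: adjoint_embedding_def adjoint_embedding_axioms_def embedding_def heyting_nabla_hom_def)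

section \<open>Amalgamation for both kinds of classes\<close>

lemma amalgamation_variety:
  fixes C :: "condition set"
  assumes inf: "infinite (UNIV :: 'a set)" and DN: "Cond_D \<in> C" "Cond_N \<in> C"
  shows "amalgamation_property nabla_hom (variety C :: 'a nabla_algebra set)"
  unfolding amalgamation_property_def
proof (intro ballI allI impI)
  fix A0 A1 A2 :: "'a nabla_algebra" and f1 f2
  assume A: "A0 \<in> variety C" "A1 \<in> variety C" "A2 \<in> variety C"
    and f: "embedding nabla_hom A0 A1 f1 \<and> embedding nabla_hom A0 A2 f2"
  have adj: "adjoint_lattice X (nabla X) (imp X)" if "X \<in> variety C" for X :: "'a nabla_algebra"
    using that DN nabla_adjoint_lattice unfolding variety_def by blast
  have span: "adjoint_span A0 (nabla A0) (imp A0) A1 (nabla A1) (imp A1) A2 (nabla A2) (imp A2) f1 f2"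
    using A f by (intro adjoint_span.intro nabla_adjoint_embedding adj) auto
  interpret adjoint_span A0 "nabla A0" "imp A0" A1 "nabla A1" "imp A1" A2 "nabla A2" "imp A2" f1 f2
    by (rule span)
  interpret R1: representation A1 "nabla A1" "imp A1" Z pair_le p fst by (rule representation_fst)
  \<comment> \<open>There is no further operation to close under, so \<open>up_imp\<close> is also
    used for \<open>K\<close>.\<close>
  obtain S and h :: "('a set \<times> 'a set) set \<Rightarrow> 'a" where S: "S \<subseteq> upsets Z pair_le" "inj_on h S"
    and hats: "hat Z fst ` carrier A1 \<subseteq> S" "hat Z snd ` carrier A2 \<subseteq> S"
    and closed: "\<And>U V. \<lbrakk>U \<in> S; V \<in> S\<rbrakk> \<Longrightarrow> U \<union> V \<in> S" "\<And>U V. \<lbrakk>U \<in> S; V \<in> S\<rbrakk> \<Longrightarrow> U \<inter> V \<in> S"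
      "\<And>U. U \<in> S \<Longrightarrow> up_nabla Z p U \<in> S"
      "\<And>U V. \<lbrakk>U \<in> S; V \<in> S\<rbrakk> \<Longrightarrow> up_imp Z pair_le p U V \<in> S"
    by (rule amalgam_carrier[where K = "up_imp Z pair_le p", OF inf inj_on_id inj_on_id up_imp_closed])
      (rule that)
  define k where "k = inv_into S h"
  have k: "k (h U) = U" if "U \<in> S" for U using S(2) that by (simp add: k_def)
  \<comment> \<open>The algebra on \<open>S\<close> is copied along \<open>h\<close>; its order and
    operations are computed through the inverse \<open>k\<close>.\<close>
  define B :: "'a nabla_algebra" where
    "B = \<lparr>carrier = h ` S, eq = (=), le = (\<lambda>u v. k u \<subseteq> k v), nabla = (\<lambda>u. h (up_nabla Z p (k u))),
      imp = (\<lambda>u v. h (up_imp Z pair_le p (k u) (k v)))\<rparr>"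
  \<comment> \<open>Both are Stone images, of \<open>\<bottom>\<close> and \<open>\<top>\<close> in
    \<open>A1\<close>, and so belong to the generators.\<close>
  have ends: "{} \<in> S" "Z \<in> S"
    using hats(1) R1.hat_bottom R1.hat_top E1.L.bottom_closed E1.L.top_closed by force+
  have B: "set_algebra B S Z h (up_nabla Z p) (up_imp Z pair_le p)"
  proof
    show "up_nabla Z p W \<inter> U \<subseteq> V \<longleftrightarrow> W \<subseteq> up_imp Z pair_le p U V" if "W \<in> S" for U V W
      using that S(1) by (intro up_adjoint) auto
    show "U \<subseteq> Z" if "U \<in> S" for U
      using that S(1) by (auto simp: upsets_def)
  qed (simp_all add: B_def k S closed ends)
  have "satisfies B c" if "c \<in> C" for c
    using set_algebra_satisfies[OF span B S(1)] A that by (simp add: variety_def)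
  then have BV: "B \<in> variety C" using set_algebra.nabla_algebra[OF B] by (simp add: variety_def)
  have e1: "embedding nabla_hom A1 B (h \<circ> hat Z fst)"
    by (rule set_algebra_embedding[OF representation_fst B hats(1)])
  have e2: "embedding nabla_hom A2 B (h \<circ> hat Z snd)"
    by (rule set_algebra_embedding[OF representation_snd B hats(2)])
  have span_eq: "\<forall>x\<in>carrier A0. (h \<circ> hat Z fst) (f1 x) = (h \<circ> hat Z snd) (f2 x)"
    using hat_span by simp
  show "\<exists>B\<in>(variety C :: 'a nabla_algebra set). \<exists>g1 g2. embedding nabla_hom A1 B g1 \<and>
      embedding nabla_hom A2 B g2 \<and> (\<forall>x\<in>carrier A0. g1 (f1 x) = g2 (f2 x))"
    using BV e1 e2 span_eq by blast
qed

text \<open>The same frame carries two span structures, one for \<open>nabla\<close> with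
  \<open>imp\<close> and one for the identity with \<open>himp\<close>. The family \<open>S\<close>
  is closed under both implications.\<close>

lemma amalgamation_variety_H:
  fixes C :: "condition set"
  assumes inf: "infinite (UNIV :: 'a set)" and N: "Cond_N \<in> C"
  shows "amalgamation_property heyting_nabla_hom (variety_H C :: 'a heyting_nabla_algebra set)"
  unfolding amalgamation_property_def
proof (intro ballI allI impI)
  fix A0 A1 A2 :: "'a heyting_nabla_algebra" and f1 f2
  assume A: "A0 \<in> variety_H C" "A1 \<in> variety_H C" "A2 \<in> variety_H C"
    and f: "embedding heyting_nabla_hom A0 A1 f1 \<and> embedding heyting_nabla_hom A0 A2 f2"
  have heyt: "heyting_nabla_algebra X" if "X \<in> variety_H C" for X :: "'a heyting_nabla_algebra"
    using that by (simp add: variety_H_def)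
  have adj: "adjoint_lattice X (nabla X) (imp X)" if "X \<in> variety_H C" for X :: "'a heyting_nabla_algebra"
    using that N heyt[OF that]
    by (intro nabla_adjoint_lattice heyting_nabla_algebra.satisfies_D)
      (auto simp: variety_H_def heyting_nabla_algebra_def)
  have f': "embedding nabla_hom A0 A1 f1" "embedding nabla_hom A0 A2 f2"
    using f by (auto simp: embedding_def heyting_nabla_hom_def)
  have span: "adjoint_span A0 (nabla A0) (imp A0) A1 (nabla A1) (imp A1) A2 (nabla A2) (imp A2) f1 f2"
    using A f' by (intro adjoint_span.intro nabla_adjoint_embedding adj)
  interpret adjoint_span A0 "nabla A0" "imp A0" A1 "nabla A1" "imp A1" A2 "nabla A2" "imp A2" f1 f2
    by (rule span)
  interpret R1: representation A1 "nabla A1" "imp A1" Z pair_le p fst by (rule representation_fst)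
  interpret H: adjoint_span A0 "\<lambda>a. a" "himp A0" A1 "\<lambda>a. a" "himp A1" A2 "\<lambda>a. a" "himp A2" f1 f2
    using A f by (intro adjoint_span.intro heyting_adjoint_embedding heyt) auto
  interpret H1: representation A1 "\<lambda>a. a" "himp A1" Z pair_le H.p fst by (rule H.representation_fst)
  interpret H2: representation A2 "\<lambda>a. a" "himp A2" Z pair_le H.p snd by (rule H.representation_snd)
  let ?K = "up_imp Z pair_le H.p"
  obtain S and h :: "('a set \<times> 'a set) set \<Rightarrow> 'a" where S: "S \<subseteq> upsets Z pair_le" "inj_on h S"
    and hats: "hat Z fst ` carrier A1 \<subseteq> S" "hat Z snd ` carrier A2 \<subseteq> S"
    and closed: "\<And>U V. \<lbrakk>U \<in> S; V \<in> S\<rbrakk> \<Longrightarrow> U \<union> V \<in> S" "\<And>U V. \<lbrakk>U \<in> S; V \<in> S\<rbrakk> \<Longrightarrow> U \<inter> V \<in> S"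
      "\<And>U. U \<in> S \<Longrightarrow> up_nabla Z p U \<in> S"
      "\<And>U V. \<lbrakk>U \<in> S; V \<in> S\<rbrakk> \<Longrightarrow> up_imp Z pair_le p U V \<in> S"
      "\<And>U V. \<lbrakk>U \<in> S; V \<in> S\<rbrakk> \<Longrightarrow> ?K U V \<in> S"
    by (rule amalgam_carrier[where K = ?K, OF inf inj_on_id inj_on_id H.up_imp_closed])
      (rule that)
  define k where "k = inv_into S h"
  have k: "k (h U) = U" if "U \<in> S" for U using S(2) that by (simp add: k_def)
  define B :: "'a heyting_nabla_algebra" where
    "B = \<lparr>carrier = h ` S, eq = (=), le = (\<lambda>u v. k u \<subseteq> k v), nabla = (\<lambda>u. h (up_nabla Z p (k u))),
      imp = (\<lambda>u v. h (up_imp Z pair_le p (k u) (k v))), himp = (\<lambda>u v. h (?K (k u) (k v)))\<rparr>"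
  have ends: "{} \<in> S" "Z \<in> S"
    using hats(1) R1.hat_bottom R1.hat_top E1.L.bottom_closed E1.L.top_closed by force+
  have sub: "U \<subseteq> Z" if "U \<in> S" for U
    using that S(1) by (auto simp: upsets_def)
  have B: "set_algebra B S Z h (up_nabla Z p) (up_imp Z pair_le p)"
  proof
    show "up_nabla Z p W \<inter> U \<subseteq> V \<longleftrightarrow> W \<subseteq> up_imp Z pair_le p U V" if "W \<in> S" for U V W
      using that S(1) by (intro up_adjoint) auto
  qed (simp_all add: B_def k S closed ends sub)
  interpret B: set_algebra B S Z h "up_nabla Z p" "up_imp Z pair_le p" by (rule B)
  have himp_B: "himp B (h U) (h V) = h (?K U V)" if "U \<in> S" "V \<in> S" for U V
    using that by (simp add: B_def k)
  \<comment> \<open>On \<open>Z\<close> the map of the Heyting span is the identity, so its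
    \<open>up_nabla\<close> fixes the members of \<open>S\<close> and \<open>H.up_adjoint\<close>
    becomes the Heyting adjunction.\<close>
  have "H.p z = z" if "z \<in> Z" for z
    using that by (auto simp: fibre_product_def pre_id)
  then have "up_nabla Z H.p U = U" if "U \<in> S" for U
    using sub[OF that] by (auto simp: up_nabla_def)
  then have K_adjoint: "W \<inter> U \<subseteq> V \<longleftrightarrow> W \<subseteq> ?K U V" if "W \<in> S" for U V W
    using H.up_adjoint[of W U V] S(1) that by auto
  have "heyting_nabla_algebra B"
  proof (intro heyting_nabla_algebra.intro B.nabla_algebra heyting_nabla_algebra_axioms.intro)
    show "himp B a b \<in> carrier B" if "a \<in> carrier B" "b \<in> carrier B" for a b
      using that by (auto simp: B.carrier himp_B closed)
    show "c \<sqinter>\<^bsub>B\<^esub> a \<sqsubseteq>\<^bsub>B\<^esub> b \<longleftrightarrow> c \<sqsubseteq>\<^bsub>B\<^esub> himp B a b"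
      if "a \<in> carrier B" "b \<in> carrier B" "c \<in> carrier B" for a b c
      using that by (auto simp: B.carrier himp_B closed B.meet B.le K_adjoint)
  qed
  moreover have "satisfies B c" if "c \<in> C" for c
    using set_algebra_satisfies[OF span B S(1)] A that by (simp add: variety_H_def)
  ultimately have BV: "B \<in> variety_H C" by (simp add: variety_H_def)
  have e1: "embedding heyting_nabla_hom A1 B (h \<circ> hat Z fst)"
    using set_algebra_embedding[OF representation_fst B hats(1)] hats(1)
    by (auto simp: embedding_def heyting_nabla_hom_def H1.hat_j himp_B image_subset_iff)
  have e2: "embedding heyting_nabla_hom A2 B (h \<circ> hat Z snd)"
    using set_algebra_embedding[OF representation_snd B hats(2)] hats(2)
    by (auto simp: embedding_def heyting_nabla_hom_def H2.hat_j himp_B image_subset_iff)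
  have span_eq: "\<forall>x\<in>carrier A0. (h \<circ> hat Z fst) (f1 x) = (h \<circ> hat Z snd) (f2 x)"
    using hat_span by simp
  show "\<exists>B\<in>(variety_H C :: 'a heyting_nabla_algebra set). \<exists>g1 g2. embedding heyting_nabla_hom A1 B g1 \<and>
      embedding heyting_nabla_hom A2 B g2 \<and> (\<forall>x\<in>carrier A0. g1 (f1 x) = g2 (f2 x))"
    using BV e1 e2 span_eq by blast
qed

theorem theorem6p10:
  fixes C :: "condition set"
  assumes "infinite (UNIV :: 'a set)"
    and "C \<subseteq> {Cond_R, Cond_L, Cond_Fa}"
  shows "amalgamation_property nabla_hom
           (variety (C \<union> {Cond_D, Cond_N}) :: 'a nabla_algebra set) \<and>
         amalgamation_property heyting_nabla_hom
           (variety_H (C \<union> {Cond_N}) :: 'a heyting_nabla_algebra set)"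
  using amalgamation_variety[OF assms(1)] amalgamation_variety_H[OF assms(1)] by simp

end
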